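(* There is a constant $C>0$ such that for all $(w,s)\in\mathbb C^2$, setting $R=|w|+|s|+1$, one has $|\xi_{\mathbb Q}(w,s)|\le e^{CR\log R}$.
   Context: $\theta(t)=\sum_{n\in\mathbb Z}e^{-\pi n^2t}$ for $t>0$. $Z_{\mathbb Q}(w,s)=\int_0^\infty\theta(t^2)^s\theta(1/t^2)^{w-s}\frac{dt}{t}$ for $\Re(w)<\Re(s)<0$, continued meromorphically to $\mathbb C^2$. $\xi_{\mathbb Q}(w,s)=\frac{s(s-w)}{2w}Z_{\mathbb Q}(w,s)$ extends to an entire function on $\mathbb C^2$, and $\xi_{\mathbb Q}$ denotes this entire function. *)

theory Defs
  imports "HOL-Complex_Analysis.Complex_Analysis"
begin

text \<open>Restricted below to positive arguments, where the series converges.\<close>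

definition theta :: "real \<Rightarrow> real" where
  "theta t = (\<Sum>\<^sub>\<infinity>n\<in>(UNIV :: int set). exp (- pi * (of_int n)\<^sup>2 * t))"

text \<open>
  The defining integral, meaningful for \<open>Re w < Re s < 0\<close>, where it converges absolutely.
  The bases of the powers are positive reals, so \<open>powr\<close> uses the real logarithm.
\<close>

definition Z_Q :: "complex \<Rightarrow> complex \<Rightarrow> complex" where
  "Z_Q w s = (LINT t:{0<..}|lborel.
      complex_of_real (theta (t\<^sup>2)) powr s * complex_of_real (theta (1 / t\<^sup>2)) powr (w - s)
        / complex_of_real t)"

text \<open>
  Entire functions on \<open>\<complex>\<^sup>2\<close>: at every point there is a total derivative which is
  \<open>\<complex>\<close>-linear, i.e. of the form \<open>(h, k) \<mapsto> a h + b k\<close> with complex \<open>a\<close>, \<open>b\<close>.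
\<close>

definition entire2 :: "(complex \<times> complex \<Rightarrow> complex) \<Rightarrow> bool" where
  "entire2 f \<longleftrightarrow> (\<forall>p. \<exists>a b. (f has_derivative (\<lambda>(h, k). a * h + b * k)) (at p))"

text \<open>
  The region \<open>Re w < Re s < 0\<close> is open and nonempty and avoids \<open>w = 0\<close>, so by the identity
  theorem at most one entire function extends \<open>s (s - w) / (2 w) Z_Q w s\<close> from it; it then also
  agrees with the meromorphic continuation of that expression wherever the latter is regular.
\<close>

definition xi_Q :: "complex \<times> complex \<Rightarrow> complex" where
  "xi_Q = (THE f. entire2 f \<and>
      (\<forall>w s. Re w < Re s \<and> Re s < 0 \<longrightarrow> f (w, s) = s * (s - w) / (2 * w) * Z_Q w s))"

end

theory Submission
  imports Defs "HOL-Real_Asymp.Real_Asymp"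
begin

text \<open>
  Write \<open>L(t) = ln \<theta>(t\<^sup>2)\<close>. Folding the defining integral at \<open>t = 1\<close> and using
  \<open>\<theta>(1/t\<^sup>2) = t \<theta>(t\<^sup>2)\<close> gives
  \<open>Z(w, s) = \<integral>\<^sub>1\<^sup>\<infinity> exp (w L(t)) (t powr (w - s) + t powr s) dt/t\<close>. Splitting off the constant \<open>1\<close> from
  \<open>exp (w L(t))\<close> produces the polar terms, which combine with the prefactor to \<open>1/2\<close>, and the rest is
  \<open>w\<close> times \<open>J(w, s) + J(w, w - s)\<close>, where
  \<open>J(w, \<alpha>) = \<integral>\<^sub>1\<^sup>\<infinity> (exp (w L(t)) - 1) / w \<cdot> t powr \<alpha> dt/t
    = \<integral>\<^sub>1\<^sup>\<infinity> \<integral>\<^sub>0\<^sup>1 L(t) exp (w y L(t) + \<alpha> ln t) dy dt/t\<close>.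
  The last form is an absolutely convergent superposition of exponentials of linear forms, hence entire,
  and since \<open>L(t)\<close> is \<open>O(exp (-t))\<close> it is bounded by a Gamma-type integral of size \<open>exp (O(R) + R ln R)\<close>.
  So \<open>\<xi>(w, s) = 1/2 + s (s - w) / 2 \<cdot> (J(w, s) + J(w, w - s))\<close> obeys the same kind of bound; because
  \<open>s (s - w)\<close> is at most \<open>(R - 1)\<^sup>2\<close>, it also holds near \<open>R = 1\<close>, where \<open>R ln R\<close> vanishes.
\<close>

section \<open>The functional equation of the theta function\<close>

text \<open>
  Polya's proof: sampling \<open>(2 cos x) ^ (2 m)\<close> at the multiples of \<open>\<pi> / l\<close> expresses a finite sum of
  powers of cosines through every \<open>l\<close>-th binomial coefficient of \<open>2 m\<close>. As \<open>l \<rightarrow> \<infinity>\<close> with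
  \<open>m / l\<^sup>2 \<rightarrow> t / \<pi>\<close>, both sides converge termwise to Gaussians, and Tannery's theorem applies.
\<close>

lemma cos_le_exp:
  fixes x :: real
  assumes "0 \<le> x" "x \<le> pi / 2"
  shows "cos x \<le> exp (- x\<^sup>2 / 2)"
proof -
  have *: "y * cos y \<le> sin y" if "0 \<le> y" "y \<le> pi / 2" for y :: real
  proof -
    have "(\<lambda>y. sin y - y * cos y) 0 \<le> (\<lambda>y. sin y - y * cos y) y"
    proof (rule DERIV_nonneg_imp_nondecreasing [OF that(1)])
      fix z :: real assume z: "0 \<le> z" "z \<le> y"
      have "((\<lambda>y. sin y - y * cos y) has_real_derivative z * sin z) (at z)"
        by (auto intro!: derivative_eq_intros)
      moreover have "z * sin z \<ge> 0"
        using z that by (intro mult_nonneg_nonneg sin_ge_zero) auto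
      ultimately show "\<exists>d. ((\<lambda>y. sin y - y * cos y) has_real_derivative d) (at z) \<and> 0 \<le> d"
        by blast
    qed
    then show ?thesis by simp
  qed
  have "(\<lambda>y. cos y * exp (y\<^sup>2 / 2)) x \<le> (\<lambda>y. cos y * exp (y\<^sup>2 / 2)) 0"
  proof (rule DERIV_nonpos_imp_nonincreasing [OF assms(1)])
    fix z :: real assume z: "0 \<le> z" "z \<le> x"
    have "((\<lambda>y. cos y * exp (y\<^sup>2 / 2)) has_real_derivative
            (z * cos z - sin z) * exp (z\<^sup>2 / 2)) (at z)"
      by (auto intro!: derivative_eq_intros simp: algebra_simps)
    moreover have "(z * cos z - sin z) * exp (z\<^sup>2 / 2) \<le> 0"
      using * [of z] z assms by (intro mult_nonpos_nonneg) auto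
    ultimately show "\<exists>d. ((\<lambda>y. cos y * exp (y\<^sup>2 / 2)) has_real_derivative d) (at z) \<and> d \<le> 0"
      by blast
  qed
  then show ?thesis
    by (simp add: exp_minus field_simps)
qed

text \<open>Write the power as exp (2 m ln (cos y)) and split the exponent as 2 (m y^2) times ln
  (cos y) / y^2; the last quotient tends to -1/2.\<close>

lemma cos_power_tendsto_exp:
  fixes m :: "nat \<Rightarrow> nat" and y :: "nat \<Rightarrow> real"
  assumes y: "filterlim y (at_right 0) sequentially"
    and lim: "(\<lambda>n. real (m n) * (y n)\<^sup>2) \<longlonglongrightarrow> c"
  shows "(\<lambda>n. cos (y n) ^ (2 * m n)) \<longlonglongrightarrow> exp (- c)"
proof -
  have "((\<lambda>x::real. ln (cos x) / x\<^sup>2) \<longlongrightarrow> - 1 / 2) (at_right 0)"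
    by real_asymp
  from filterlim_compose [OF this y]
  have "(\<lambda>n. exp (2 * (real (m n) * (y n)\<^sup>2) * (ln (cos (y n)) / (y n)\<^sup>2))) \<longlonglongrightarrow> exp (2 * c * (- 1 / 2))"
    by (intro tendsto_exp tendsto_mult tendsto_const lim) auto
  \<comment> \<open>Only once y lies in (0, pi/2) is the cosine positive, so that its power may be
    written through \<open>ln\<close>.\<close>
  moreover have "\<forall>\<^sub>F n in sequentially.
      exp (2 * (real (m n) * (y n)\<^sup>2) * (ln (cos (y n)) / (y n)\<^sup>2)) = cos (y n) ^ (2 * m n)"
  proof -
    have "\<forall>\<^sub>F x in at_right (0::real). x \<in> {0<..<pi/2}"
      by (rule eventually_at_right_real) simp
    then have "\<forall>\<^sub>F n in sequentially. y n \<in> {0<..<pi/2}"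
      using y by (auto simp: filterlim_iff)
    then show ?thesis
    proof eventually_elim
      case (elim n)
      then have "cos (y n) > 0" "y n \<noteq> 0" by (auto intro!: cos_gt_zero_pi)
      then have "cos (y n) ^ (2 * m n) = exp (real (2 * m n) * ln (cos (y n)))"
        by (metis exp_ln exp_of_nat_mult)
      also have "real (2 * m n) * ln (cos (y n))
          = 2 * (real (m n) * (y n)\<^sup>2) * (ln (cos (y n)) / (y n)\<^sup>2)"
        using \<open>y n \<noteq> 0\<close> by simp
      finally show ?case by simp
    qed
  qed
  ultimately show ?thesis
    using Lim_transform_eventually by force
qed

text \<open>The ratio is a product of factors \<open>1 - (2 j + 1) / (m + j + 1)\<close> for \<open>j < K\<close>, and these numerators sum to \<open>K\<^sup>2\<close>.\<close>

lemma binomial_ratio_bounds: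
  assumes "K \<le> m"
  shows "K < m \<Longrightarrow> exp (- (real K)\<^sup>2 / (real m - real K)) \<le> real ((2 * m) choose (m + K)) / real ((2 * m) choose m)"
    and "real ((2 * m) choose (m + K)) / real ((2 * m) choose m) \<le> exp (- (real K)\<^sup>2 / (real m + real K))"
proof -
  define r where "r K = real ((2 * m) choose (m + K)) / real ((2 * m) choose m)" for K
  have r0: "r 0 = 1" by (simp add: r_def)
  have rpos: "r j \<ge> 0" for j by (simp add: r_def)
  have rS: "r (Suc j) = r j * ((real m - real j) / (real m + real j + 1))" if "j < m" for j
  proof -
    have "Suc (m + j) * ((2 * m) choose Suc (m + j)) = (2 * m - (m + j)) * ((2 * m) choose (m + j))"
      using binomial_absorb_comp [of "2*m" "m+j"] binomial_absorption [of "m+j" "2*m"] by simp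
    then have "Suc (m + j) * ((2 * m) choose Suc (m + j)) = (m - j) * ((2 * m) choose (m + j))"
      by simp
    then have "real (Suc (m + j)) * real ((2 * m) choose Suc (m + j)) = real (m - j) * real ((2 * m) choose (m + j))"
      by (simp only: flip: of_nat_mult)
    then have "(real m + real j + 1) * real ((2 * m) choose (m + Suc j))
        = (real m - real j) * real ((2 * m) choose (m + j))"
      using that by (simp add: of_nat_diff algebra_simps)
    moreover have "real m + real j + 1 \<noteq> 0" by linarith
    ultimately have "real ((2 * m) choose (m + Suc j))
        = (real m - real j) * real ((2 * m) choose (m + j)) / (real m + real j + 1)"
      by (metis nonzero_mult_div_cancel_left)
    then show ?thesis
      by (simp add: r_def mult.commute)
  qed
  \<comment> \<open>Here 1 + u <= exp u is applied to the factor itself, and the denominator m + j +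
    1 is enlarged to m + K.\<close>
  have up: "(real m - real j) / (real m + real j + 1) \<le> exp (- (2 * real j + 1) / (real m + real K))"
    if "j < K" for j
  proof -
    have "(real m - real j) / (real m + real j + 1) = 1 + (- (2 * real j + 1) / (real m + real j + 1))"
      by (simp add: field_simps)
    also have "\<dots> \<le> exp (- (2 * real j + 1) / (real m + real j + 1))"
      by (rule exp_ge_add_one_self)
    also have "\<dots> \<le> exp (- (2 * real j + 1) / (real m + real K))"
    proof -
      have "(2 * real j + 1) / (real m + real K) \<le> (2 * real j + 1) / (real m + real j + 1)"
        using that by (intro divide_left_mono) auto
      then show ?thesis by (simp only: exp_le_cancel_iff minus_divide_left [symmetric] neg_le_iff_le)
    qed
    finally show ?thesis .
  qed
  \<comment> \<open>For the lower bound 1 + u <= exp u is applied to the reciprocal of the factor,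
    and the result is inverted.\<close>
  have low: "exp (- (2 * real j + 1) / (real m - real K)) \<le> (real m - real j) / (real m + real j + 1)"
    if "j < K" "K < m" for j
  proof -
    have "(real m + real j + 1) / (real m - real j) = 1 + (2 * real j + 1) / (real m - real j)"
      using that assms by (simp add: field_simps)
    also have "\<dots> \<le> exp ((2 * real j + 1) / (real m - real j))"
      by (rule exp_ge_add_one_self)
    also have "\<dots> \<le> exp ((2 * real j + 1) / (real m - real K))"
      using that assms by (simp add: divide_left_mono)
    finally have "inverse (exp ((2 * real j + 1) / (real m - real K)))
        \<le> inverse ((real m + real j + 1) / (real m - real j))"
      using that by (intro le_imp_inverse_le) auto
    then show ?thesis
      by (simp only: exp_minus [symmetric] minus_divide_left inverse_divide)
  qed
  \<comment> \<open>The denominators m - K and m + K stay fixed during the induction on i, so the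
    exponents simply add: i^2 + (2 i + 1) = (i + 1)^2.\<close>
  have "(K < m \<longrightarrow> exp (- (real i)\<^sup>2 / (real m - real K)) \<le> r i) \<and> r i \<le> exp (- (real i)\<^sup>2 / (real m + real K))"
    if "i \<le> K" for i
    using that
  proof (induction i)
    case 0
    then show ?case by (simp add: r0)
  next
    case (Suc i)
    have "exp (- (real i)\<^sup>2 / (real m - real K)) * exp (- (2 * real i + 1) / (real m - real K))
        \<le> r i * ((real m - real i) / (real m + real i + 1))" if "K < m"
      using Suc low [of i] that rpos by (intro mult_mono) auto
    moreover have "r i * ((real m - real i) / (real m + real i + 1))
        \<le> exp (- (real i)\<^sup>2 / (real m + real K)) * exp (- (2 * real i + 1) / (real m + real K))"
      using Suc up [of i] rpos assms by (intro mult_mono) auto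
    moreover have "exp (- (real i)\<^sup>2 / q) * exp (- (2 * real i + 1) / q) = exp (- (real (Suc i))\<^sup>2 / q)" for q
      by (simp add: power2_eq_square algebra_simps flip: exp_add add_divide_distrib)
    ultimately show ?case
      using rS [of i] Suc.prems assms by simp
  qed
  from this [of K] show "K < m \<Longrightarrow> exp (- (real K)\<^sup>2 / (real m - real K)) \<le> real ((2 * m) choose (m + K)) / real ((2 * m) choose m)"
    and "real ((2 * m) choose (m + K)) / real ((2 * m) choose m) \<le> exp (- (real K)\<^sup>2 / (real m + real K))"
    by (simp_all add: r_def)
qed

text \<open>This is Wallis' product in disguise: with c = binomial / 4^m, the quantity c^2 (2 m + 1)
  is exactly the reciprocal of the m-th partial product, which tends to pi / 2. The factor m / (2 m
  + 1) supplies the remaining 1/2.\<close>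

lemma central_binomial_square_tendsto:
  "(\<lambda>m. real m * (real ((2 * m) choose m) / 4 ^ m)\<^sup>2) \<longlonglongrightarrow> 1 / pi"
proof -
  define c where "c m = real ((2 * m) choose m) / 4 ^ m" for m
  have cS: "c (Suc m) = c m * ((2 * real m + 1) / (2 * real m + 2))" for m
  proof -
    have "Suc m * Suc m * ((2 * Suc m) choose Suc m) = 2 * Suc m * (2 * m + 1) * ((2 * m) choose m)"
    proof -
      have "Suc m * ((2 * Suc m) choose Suc m) = (2 * Suc m) * ((2 * m + 1) choose m)"
        using binomial_absorption [of m "2 * Suc m"] by simp
      moreover have "Suc m * ((2 * m + 1) choose m) = (2 * m + 1) * ((2 * m) choose m)"
        using binomial_absorb_comp [of "2 * m + 1" m] by simp
      ultimately show ?thesis by (metis mult.assoc mult.left_commute)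
    qed
    then have "Suc m * ((2 * Suc m) choose Suc m) = 2 * (2 * m + 1) * ((2 * m) choose m)"
      by (metis (no_types) mult.assoc mult.left_commute mult_cancel1 nat.distinct(1))
    then have "real (Suc m) * real ((2 * Suc m) choose Suc m)
        = 2 * (2 * real m + 1) * real ((2 * m) choose m)"
      by (metis (no_types) of_nat_mult of_nat_add of_nat_numeral of_nat_1)
    moreover have "real (Suc m) = real m + 1" "real m + 1 \<noteq> 0" by auto
    ultimately have "real ((2 * Suc m) choose Suc m)
        = 2 * (2 * real m + 1) * real ((2 * m) choose m) / (real m + 1)"
      by (metis nonzero_mult_div_cancel_left)
    moreover have "2 * (2 * a + 1) * x / (a + 1) / (4 * q) = x / q * ((2 * a + 1) / (2 * (a + 1)))"
      if "a + 1 \<noteq> 0" "q \<noteq> 0" for a x q :: real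
      using that by (simp add: divide_simps) (simp add: algebra_simps)
    moreover have "2 * real m + 2 = 2 * (real m + 1)" by simp
    ultimately show ?thesis by (simp add: c_def del: binomial_Suc_Suc mult_Suc_right)
  qed
  have W: "(c m)\<^sup>2 * (2 * real m + 1) * (\<Prod>k=1..m. (4*real k^2) / (4*real k^2 - 1)) = 1" for m
  proof (induction m)
    case 0
    then show ?case by (simp add: c_def)
  next
    case (Suc m)
    have "(2 * real m + 2)\<^sup>2 - 1 = (2 * real m + 1) * (2 * real m + 3)"
      by (simp add: power2_eq_square algebra_simps)
    moreover have "4 * (real (Suc m))\<^sup>2 = (2 * real m + 2)\<^sup>2"
      by (simp add: power2_eq_square algebra_simps)
    moreover have "2 * real (Suc m) + 1 = 2 * real m + 3" by simp
    moreover have prodS: "(\<Prod>k=1..Suc m. f k) = (\<Prod>k=1..m. f k) * f (Suc m)" for f :: "nat \<Rightarrow> real"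
      by simp
    ultimately have "(c (Suc m))\<^sup>2 * (2 * real (Suc m) + 1) * (\<Prod>k=1..Suc m. (4*real k^2) / (4*real k^2 - 1))
      = (c m * ((2 * real m + 1) / (2 * real m + 2)))\<^sup>2 * (2 * real m + 3)
        * ((\<Prod>k=1..m. (4*real k^2) / (4*real k^2 - 1)) * ((2 * real m + 2)\<^sup>2 / ((2 * real m + 1) * (2 * real m + 3))))"
      by (simp only: cS prodS)
    also have "\<dots> = (c m)\<^sup>2 * (2 * real m + 1) * (\<Prod>k=1..m. (4*real k^2) / (4*real k^2 - 1))"
    proof -
      have "(x * (A / B))\<^sup>2 * D * (P * (B\<^sup>2 / (A * D))) = x\<^sup>2 * A * P"
        if "A \<noteq> 0" "B \<noteq> 0" "D \<noteq> 0" for x A B D P :: real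
        using that by (simp add: field_simps power2_eq_square)
      moreover have "2 * real m + 1 \<noteq> 0" "2 * real m + 2 \<noteq> 0" "2 * real m + 3 \<noteq> 0"
        by linarith+
      ultimately show ?thesis by blast
    qed
    finally show ?case using Suc.IH by (simp only:)
  qed
  have "(\<lambda>m. 1 / (\<Prod>k=1..m. (4*real k^2) / (4*real k^2 - 1)) * (real m / (2 * real m + 1))) \<longlonglongrightarrow> 1 / (pi/2) * (1/2)"
  proof (rule tendsto_mult)
    show "(\<lambda>m. 1 / (\<Prod>k=1..m. (4*real k^2) / (4*real k^2 - 1))) \<longlonglongrightarrow> 1 / (pi/2)"
      by (intro tendsto_divide tendsto_const wallis) auto
    show "(\<lambda>m. real m / (2 * real m + 1)) \<longlonglongrightarrow> 1 / 2" by real_asymp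
  qed
  moreover have "1 / (\<Prod>k=1..m. (4*real k^2) / (4*real k^2 - 1)) * (real m / (2 * real m + 1)) = real m * (c m)\<^sup>2" for m
  proof -
    define P where "P = (\<Prod>k=1..m. (4*real k^2) / (4*real k^2 - 1))"
    have *: "(c m)\<^sup>2 * (2 * real m + 1) * P = 1" using W [of m] by (simp add: P_def)
    then have "P \<noteq> 0" by auto
    then have "1 / P = (c m)\<^sup>2 * (2 * real m + 1)" using * by (simp add: field_simps)
    moreover have "2 * real m + 1 \<noteq> 0" by linarith
    moreover have "x * d * (y / d) = y * x" if "d \<noteq> 0" for x y d :: real
      using that by simp
    ultimately have "1 / P * (real m / (2 * real m + 1)) = real m * (c m)\<^sup>2"
      by (simp only:)
    then show ?thesis by (simp only: P_def)
  qed
  ultimately show ?thesis by (simp add: c_def)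
qed


section \<open>Sampling cosine powers at equally spaced points\<close>

text \<open>Expand (2 cos x)^(2 m) = (e^(ix) + e^(-ix))^(2 m) by the binomial theorem. Summation
  over the l sample points filters the frequencies: only those with l dividing j - m survive, each
  with weight l.\<close>

lemma sum_cos_power:
  assumes "l > 0"
  shows "(\<Sum>\<nu><l. cos (pi * real \<nu> / real l) ^ (2 * m))
       = real l / 4 ^ m * (\<Sum>j\<le>2*m. if int l dvd int j - int m then real ((2 * m) choose j) else 0)"
proof -
  have cos_pow: "complex_of_real ((2 * cos x) ^ (2 * m))
      = (\<Sum>j\<le>2*m. of_nat ((2 * m) choose j) * cis (2 * (real j - real m) * x))" for x
  proof -
    have "complex_of_real (2 * cos x) = cis x + cis (- x)"
      by (simp add: complex_eq_iff)
    then have "complex_of_real ((2 * cos x) ^ (2 * m)) = (cis x + cis (- x)) ^ (2 * m)"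
      by (metis of_real_power)
    also have "\<dots> = (\<Sum>j\<le>2*m. of_nat ((2 * m) choose j) * cis x ^ j * cis (- x) ^ (2 * m - j))"
      by (rule binomial_ring)
    also have "\<dots> = (\<Sum>j\<le>2*m. of_nat ((2 * m) choose j) * cis (2 * (real j - real m) * x))"
    proof (rule sum.cong [OF refl])
      fix j assume "j \<in> {..2*m}"
      then have "real j * x + real (2 * m - j) * (- x) = 2 * (real j - real m) * x"
        by (simp add: of_nat_diff algebra_simps)
      then have "cis x ^ j * cis (- x) ^ (2 * m - j) = cis (2 * (real j - real m) * x)"
        by (simp only: Complex.DeMoivre cis_mult)
      then show "of_nat ((2 * m) choose j) * cis x ^ j * cis (- x) ^ (2 * m - j)
          = of_nat ((2 * m) choose j) * cis (2 * (real j - real m) * x)"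
        by (simp add: mult.assoc)
    qed
    finally show ?thesis .
  qed
  \<comment> \<open>The sum is geometric with ratio \<open>cis \<theta>\<close>, an l-th root of
    unity; it equals l if the ratio is 1 and 0 otherwise.\<close>
  have geom: "(\<Sum>\<nu><l. cis (2 * (real j - real m) * (pi * real \<nu> / real l)))
      = (if int l dvd int j - int m then of_nat l else 0)" for j
  proof -
    define \<theta> where "\<theta> = 2 * pi * ((real j - real m) / real l)"
    have eq: "(\<Sum>\<nu><l. cis (2 * (real j - real m) * (pi * real \<nu> / real l))) = (\<Sum>\<nu><l. cis \<theta> ^ \<nu>)"
      by (intro sum.cong refl) (simp add: Complex.DeMoivre \<theta>_def mult_ac)
    show ?thesis
    proof (cases "int l dvd int j - int m")
      case True
      then obtain q where "int j - int m = int l * q" by auto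
      then have "real j - real m = real l * of_int q"
        by (metis of_int_diff of_int_mult of_int_of_nat_eq)
      then have "cis \<theta> = 1"
        using assms by (simp add: \<theta>_def)
      then show ?thesis using True eq by simp
    next
      case False
      have "cis \<theta> \<noteq> 1"
      proof
        assume "cis \<theta> = 1"
        then have "cos \<theta> = 1" by (metis cis.sel(1) one_complex.sel(1))
        then obtain n :: int where "\<theta> = of_int n * 2 * pi" by (auto simp: cos_one_2pi_int)
        then have "2 * pi * ((real j - real m) / real l - of_int n) = 0"
          by (simp add: \<theta>_def algebra_simps)
        then have "(real j - real m) / real l = of_int n" by simp
        then have "real j - real m = of_int n * real l"
          using assms by (simp add: divide_eq_eq)
        then have "of_int (int j - int m) = (of_int (n * int l) :: real)" by simp
        then have "int j - int m = n * int l" by (simp only: of_int_eq_iff)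
        then show False using False by simp
      qed
      moreover have "cis \<theta> ^ l = 1"
      proof -
        have "real l * \<theta> = 2 * pi * of_int (int j - int m)" using assms by (simp add: \<theta>_def)
        then show ?thesis using cis_multiple_2pi [of "of_int (int j - int m)"] by (simp only: Complex.DeMoivre Ints_of_int)
      qed
      ultimately show ?thesis using False eq by (simp add: geometric_sum)
    qed
  qed
  have "complex_of_real (\<Sum>\<nu><l. (2 * cos (pi * real \<nu> / real l)) ^ (2 * m))
     = (\<Sum>\<nu><l. \<Sum>j\<le>2*m. of_nat ((2 * m) choose j) * cis (2 * (real j - real m) * (pi * real \<nu> / real l)))"
    by (simp only: of_real_sum cos_pow)
  also have "\<dots> = (\<Sum>j\<le>2*m. \<Sum>\<nu><l. of_nat ((2 * m) choose j) * cis (2 * (real j - real m) * (pi * real \<nu> / real l)))"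
    by (rule sum.swap)
  also have "\<dots> = (\<Sum>j\<le>2*m. of_nat ((2 * m) choose j) * (if int l dvd int j - int m then of_nat l else 0))"
    by (simp only: geom flip: sum_distrib_left)
  also have "\<dots> = complex_of_real (real l * (\<Sum>j\<le>2*m. if int l dvd int j - int m then real ((2 * m) choose j) else 0))"
    by (simp add: sum_distrib_left if_distrib mult.commute cong: if_cong)
  finally have "(\<Sum>\<nu><l. (2 * cos (pi * real \<nu> / real l)) ^ (2 * m))
     = real l * (\<Sum>j\<le>2*m. if int l dvd int j - int m then real ((2 * m) choose j) else 0)"
    by (simp only: of_real_eq_iff)
  moreover have "(2 :: real) ^ (2 * m) = 4 ^ m"
    by (simp add: power_mult)
  ultimately have "4 ^ m * (\<Sum>\<nu><l. cos (pi * real \<nu> / real l) ^ (2 * m))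
     = real l * (\<Sum>j\<le>2*m. if int l dvd int j - int m then real ((2 * m) choose j) else 0)"
    by (simp only: power_mult_distrib sum_distrib_left [symmetric])
  then show ?thesis
    by (simp add: field_simps)
qed

text \<open>The surviving indices are m plus multiples of l, and the symmetry j to 2 m - j folds the
  lower half onto the upper. The range k < m is generous: it contains every index up to 2 m because
  l >= 1, and beyond 2 m the binomial coefficients vanish.\<close>

lemma binomial_sum_dvd:
  assumes "l > 0"
  shows "(\<Sum>j\<le>2*m. if int l dvd int j - int m then real ((2 * m) choose j) else 0)
       = real ((2 * m) choose m) + 2 * (\<Sum>k<m. real ((2 * m) choose (m + Suc k * l)))"
proof -
  define f where "f j = (if int l dvd int j - int m then real ((2 * m) choose j) else 0)" for j
  have split: "{..2*m} = {..<m} \<union> {m} \<union> {m<..2*m}" by auto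
  have "sum f {..2*m} = sum f {..<m} + f m + sum f {m<..2*m}"
    unfolding split by (subst sum.union_disjoint; force)+
  moreover have "sum f {..<m} = sum f {m<..2*m}"
  proof (rule sum.reindex_bij_witness [of _ "\<lambda>j. 2*m - j" "\<lambda>j. 2*m - j"])
    fix j assume "j \<in> {..<m}"
    then have "int (2 * m - j) - int m = - (int j - int m)" by auto
    then have "int l dvd int (2 * m - j) - int m \<longleftrightarrow> int l dvd int j - int m"
      by (metis dvd_minus_iff)
    moreover have "(2 * m) choose (2 * m - j) = (2 * m) choose j"
      using \<open>j \<in> {..<m}\<close> by (intro binomial_symmetric [symmetric]) auto
    ultimately show "f (2 * m - j) = f j" by (simp add: f_def)
  qed auto
  moreover have "sum f {m<..2*m} = (\<Sum>k<m. real ((2 * m) choose (m + Suc k * l)))"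
  proof -
    have "(\<Sum>k<m. real ((2 * m) choose (m + Suc k * l))) = sum (\<lambda>j. real ((2 * m) choose j)) ((\<lambda>k. m + Suc k * l) ` {..<m})"
      using assms by (subst sum.reindex) (auto simp: inj_on_def)
    also have "\<dots> = sum (\<lambda>j. real ((2 * m) choose j)) {j \<in> {m<..2*m}. int l dvd int j - int m}"
    proof (rule sum.mono_neutral_right)
      show "{j \<in> {m<..2*m}. int l dvd int j - int m} \<subseteq> (\<lambda>k. m + Suc k * l) ` {..<m}"
      proof
        fix j assume "j \<in> {j \<in> {m<..2*m}. int l dvd int j - int m}"
        then have j: "m < j" "j \<le> 2 * m" "int l dvd int j - int m" by auto
        then have "int l dvd int (j - m)" by (simp add: of_nat_diff)
        then have "l dvd j - m" by simp
        then obtain q where q: "j - m = l * q" by blast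
        with j have "q > 0" by (cases q) auto
        then obtain k where k: "q = Suc k" by (cases q) auto
        have "k < m"
        proof -
          have "1 * Suc k \<le> l * q" unfolding k using assms by (intro mult_le_mono1) simp
          also have "\<dots> = j - m" using q by simp
          also have "\<dots> \<le> m" using j by auto
          finally show ?thesis by simp
        qed
        moreover have "j = m + Suc k * l"
        proof -
          have "j = m + (j - m)" using j by simp
          also have "j - m = Suc k * l" using q k by (simp add: mult.commute)
          finally show ?thesis .
        qed
        ultimately show "j \<in> (\<lambda>k. m + Suc k * l) ` {..<m}" by blast
      qed
      show "\<forall>i\<in>(\<lambda>k. m + Suc k * l) ` {..<m} - {j \<in> {m<..2*m}. int l dvd int j - int m}. real ((2 * m) choose i) = 0"
      proof
        fix i assume "i \<in> (\<lambda>k. m + Suc k * l) ` {..<m} - {j \<in> {m<..2*m}. int l dvd int j - int m}"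
        then obtain k where i: "i = m + Suc k * l"
          and "m + Suc k * l \<notin> {j \<in> {m<..2*m}. int l dvd int j - int m}" by blast
        moreover have "int l dvd int (m + Suc k * l) - int m" by simp
        moreover have "m < m + Suc k * l" using assms by simp
        ultimately have "m + Suc k * l > 2 * m" by (metis (mono_tags, lifting) greaterThanAtMost_iff mem_Collect_eq not_le)
        then show "real ((2 * m) choose i) = 0" unfolding i by (simp add: binomial_eq_0)
      qed
    qed auto
    also have "\<dots> = sum f {m<..2*m}"
      unfolding f_def by (rule sum.inter_filter) auto
    finally show ?thesis by simp
  qed
  moreover have "f m = real ((2 * m) choose m)" by (simp add: f_def)
  ultimately show ?thesis by (simp add: f_def)
qed

text \<open>For odd l = 2 p + 1 the reflection of nu to l - nu pairs the nonzero sample points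
  without a fixed point, leaving p points with angles in (0, pi/2). Taking out the central binomial
  coefficient leaves ratios that have a Gaussian limit.\<close>

lemma sum_cos_power_odd:
  "1 + 2 * (\<Sum>\<nu><p. cos (pi * real (Suc \<nu>) / real (2 * p + 1)) ^ (2 * m))
    = real (2 * p + 1) * (real ((2 * m) choose m) / 4 ^ m)
      * (1 + 2 * (\<Sum>k<m. real ((2 * m) choose (m + Suc k * (2 * p + 1))) / real ((2 * m) choose m)))"
proof -
  define l where "l = 2 * p + 1"
  define f where "f \<nu> = cos (pi * real \<nu> / real l) ^ (2 * m)" for \<nu>
  have l: "l > 0" by (simp add: l_def)
  have split: "{..<l} = {0} \<union> {1..p} \<union> {p<..<l}" by (auto simp: l_def)
  have "sum f {..<l} = f 0 + sum f {1..p} + sum f {p<..<l}"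
    unfolding split by (subst sum.union_disjoint; force)+
  \<comment> \<open>The reflection turns cos x into cos (pi - x) = - cos x, and the exponent is
    even.\<close>
  moreover have "sum f {p<..<l} = sum f {1..p}"
  proof (rule sum.reindex_bij_witness [of _ "\<lambda>j. l - j" "\<lambda>j. l - j"])
    fix j assume "j \<in> {p<..<l}"
    then have "real (l - j) = real l - real j" by (simp add: of_nat_diff)
    then have "pi * real (l - j) / real l = pi - pi * real j / real l"
      using l by (simp add: field_simps)
    then show "f (l - j) = f j" by (simp add: f_def)
  qed (auto simp: l_def)
  moreover have "sum f {1..p} = (\<Sum>\<nu><p. f (Suc \<nu>))"
    by (rule sum.reindex_bij_witness [of _ Suc "\<lambda>j. j - 1"]) auto
  moreover have "f 0 = 1" by (simp add: f_def)
  ultimately have "1 + 2 * (\<Sum>\<nu><p. f (Suc \<nu>)) = sum f {..<l}" by simp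
  also have "\<dots> = real l / 4 ^ m * (real ((2 * m) choose m) + 2 * (\<Sum>k<m. real ((2 * m) choose (m + Suc k * l))))"
    unfolding f_def using sum_cos_power [OF l] binomial_sum_dvd [OF l] by simp
  also have "\<dots> = real l * (real ((2 * m) choose m) / 4 ^ m)
      * (1 + 2 * (\<Sum>k<m. real ((2 * m) choose (m + Suc k * l)) / real ((2 * m) choose m)))"
  proof -
    have "C + 2 * S = C * (1 + 2 * (S / C))" if "C \<noteq> 0" for C S :: real
      using that by (simp add: field_simps)
    from this [of "real ((2 * m) choose m)"] show ?thesis
      by (simp flip: sum_divide_distrib)
  qed
  finally show ?thesis by (simp only: f_def l_def)
qed


section \<open>The theta series over positive integers and the limit in the finite identity\<close>

text \<open>An ordinary series over \<open>nat\<close> is the form that Tannery's theorem handles;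
  index n stands for the integer n + 1.\<close>

definition half_theta :: "real \<Rightarrow> real" where
  "half_theta t = (\<Sum>n. exp (- pi * (real (Suc n))\<^sup>2 * t))"

lemma half_theta_term_le:
  assumes "t \<ge> 0"
  shows "exp (- pi * (real (Suc n))\<^sup>2 * t) \<le> exp (- pi * t) ^ Suc n"
proof -
  have "real (Suc n) * 1 \<le> real (Suc n) * real (Suc n)"
    by (intro mult_left_mono) auto
  then have "pi * t * real (Suc n) \<le> pi * t * (real (Suc n))\<^sup>2"
    using assms by (intro mult_left_mono) (auto simp: power2_eq_square)
  then have "exp (- pi * (real (Suc n))\<^sup>2 * t) \<le> exp (real (Suc n) * (- pi * t))"
    by (simp add: mult_ac del: of_nat_Suc)
  also have "\<dots> = exp (- pi * t) ^ Suc n"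
    by (rule exp_of_nat_mult)
  finally show ?thesis .
qed

lemma half_theta_sums:
  assumes "t > 0"
  shows "(\<lambda>n. exp (- pi * (real (Suc n))\<^sup>2 * t)) sums half_theta t"
proof -
  have "summable (\<lambda>n. exp (- pi * t) ^ Suc n)"
    using assms by (subst summable_Suc_iff) (auto intro!: summable_geometric)
  then have "summable (\<lambda>n. exp (- pi * (real (Suc n))\<^sup>2 * t))"
    by (rule summable_comparison_test') (use half_theta_term_le [of t] assms in auto)
  then show ?thesis by (simp add: half_theta_def summable_sums)
qed

lemma theta_eq_half_theta:
  assumes "t > 0"
  shows "theta t = 1 + 2 * half_theta t"
proof -
  define f where "f n = exp (- pi * (of_int n)\<^sup>2 * t)" for n :: int
  have 1: "((\<lambda>n. exp (- pi * (real (Suc n))\<^sup>2 * t)) has_sum half_theta t) UNIV"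
    using half_theta_sums [OF assms] by (intro sums_nonneg_imp_has_sum) auto
  have pos: "(f has_sum half_theta t) {1..}"
    using 1 by (subst has_sum_reindex_bij_witness [of _ "\<lambda>n. int (Suc n)" "\<lambda>i. nat (i - 1)" UNIV])
       (auto simp: f_def)
  have neg: "(f has_sum half_theta t) {..-1}"
    using 1 by (subst has_sum_reindex_bij_witness [of _ "\<lambda>n. - int (Suc n)" "\<lambda>i. nat (- i - 1)" UNIV])
       (auto simp: f_def)
  have zero: "(f has_sum 1) {0}"
    using has_sum_finite [of "{0}" f] by (simp add: f_def)
  have "(f has_sum (1 + half_theta t + half_theta t)) ({0} \<union> {1..} \<union> {..-1})"
    by (intro has_sum_Un_disjoint pos neg zero) auto
  moreover have "{0} \<union> {1..} \<union> {..-1} = (UNIV :: int set)" by auto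
  moreover have "1 + half_theta t + half_theta t = 1 + 2 * half_theta t" by simp
  ultimately have "(f has_sum (1 + 2 * half_theta t)) UNIV" by (simp only:)
  then show ?thesis
    unfolding theta_def f_def by (rule infsumI)
qed

text \<open>Take l = 2 p + 1 in \<open>sum_cos_power_odd\<close> and let p tend to infinity: the
  cosine sum tends to the series at t, the binomial sum to the series at 1/t, and the prefactor to 1
  / sqrt t.\<close>

lemma half_theta_functional_equation:
  assumes t: "t > 0"
  shows "1 + 2 * half_theta t = (1 + 2 * half_theta (1 / t)) / sqrt t"
proof -
  \<comment> \<open>With m / l^2 tending to t / pi, the cosine exponents m (pi n / l)^2 tend to pi
    n^2 t and the binomial exponents (n l)^2 / m tend to pi n^2 / t.\<close>
  define \<tau> where "\<tau> = t / pi"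
  define m where "m p = nat \<lfloor>\<tau> * (real (2 * p + 1))\<^sup>2\<rfloor>" for p
  define q where "q p = real (m p) / (real (2 * p + 1))\<^sup>2" for p
  \<comment> \<open>Padding by zero beyond p turns the finite sum into a series, as Tannery's
    theorem requires; for \<open>r\<close> the vanishing binomial coefficients do this by
    themselves.\<close>
  define a where "a \<nu> p = (if \<nu> < p then cos (pi * real (Suc \<nu>) / real (2 * p + 1)) ^ (2 * m p) else 0)" for \<nu> p
  define r where "r k p = real ((2 * m p) choose (m p + Suc k * (2 * p + 1))) / real ((2 * m p) choose m p)" for k p
  have \<tau>: "\<tau> > 0" using t by (simp add: \<tau>_def)
  have m_real: "real (m p) = of_int \<lfloor>\<tau> * (real (2 * p + 1))\<^sup>2\<rfloor>" for p
    using \<tau> by (simp add: m_def)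
  have q: "q \<longlonglongrightarrow> \<tau>"
    unfolding q_def m_real using \<tau> by real_asymp
  have m_top: "filterlim m at_top sequentially"
  proof -
    have "filterlim (\<lambda>p. real (m p)) at_top sequentially"
      unfolding m_real using \<tau> by real_asymp
    then show ?thesis by (simp add: filterlim_sequentially_iff_filterlim_real)
  qed
  have q_bounds: "\<forall>\<^sub>F p in sequentially. \<tau> / 2 < q p \<and> q p < 2 * \<tau>"
    using order_tendstoD(1) [OF q, of "\<tau> / 2"] order_tendstoD(2) [OF q, of "2 * \<tau>"] \<tau>
    by (intro eventually_conj) auto
  have q_mult: "real (m p) = q p * (real (2 * p + 1))\<^sup>2" for p
  proof -
    have "(real (2 * p + 1))\<^sup>2 \<noteq> 0" by simp
    then show ?thesis unfolding q_def by (metis nonzero_eq_divide_eq)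
  qed

  have lim_a: "a \<nu> \<longlonglongrightarrow> exp (- pi * (real (Suc \<nu>))\<^sup>2 * t)" for \<nu>
  proof -
    have "(\<lambda>p. cos (pi * real (Suc \<nu>) / real (2 * p + 1)) ^ (2 * m p)) \<longlonglongrightarrow> exp (- (\<tau> * (pi * real (Suc \<nu>))\<^sup>2))"
    proof (rule cos_power_tendsto_exp)
      show "filterlim (\<lambda>p. pi * real (Suc \<nu>) / real (2 * p + 1)) (at_right 0) sequentially"
        by real_asymp
      have "(\<lambda>p. q p * (pi * real (Suc \<nu>))\<^sup>2) \<longlonglongrightarrow> \<tau> * (pi * real (Suc \<nu>))\<^sup>2"
        by (intro tendsto_intros q)
      then show "(\<lambda>p. real (m p) * (pi * real (Suc \<nu>) / real (2 * p + 1))\<^sup>2) \<longlonglongrightarrow> \<tau> * (pi * real (Suc \<nu>))\<^sup>2"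
        by (simp add: q_def power_divide)
    qed
    moreover have "\<tau> * (pi * real (Suc \<nu>))\<^sup>2 = pi * (real (Suc \<nu>))\<^sup>2 * t"
      by (simp add: \<tau>_def power2_eq_square)
    moreover have "\<forall>\<^sub>F p in sequentially. cos (pi * real (Suc \<nu>) / real (2 * p + 1)) ^ (2 * m p) = a \<nu> p"
      using eventually_gt_at_top [of \<nu>] by eventually_elim (simp add: a_def)
    ultimately show ?thesis
      by (simp add: Lim_transform_eventually)
  qed
  \<comment> \<open>The Gaussian bound becomes geometric through n^2 >= n, and q > tau / 2 makes its
    ratio independent of p.\<close>
  have bound_a: "norm (a \<nu> p) \<le> exp (- (\<tau> * pi\<^sup>2 / 2)) ^ Suc \<nu>" if "\<tau> / 2 < q p" for \<nu> p
  proof (cases "\<nu> < p")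
    case True
    define x where "x = pi * real (Suc \<nu>) / real (2 * p + 1)"
    have x: "0 \<le> x" "x \<le> pi / 2"
    proof -
      have "2 * real (Suc \<nu>) \<le> real (2 * p + 1)" using True by simp
      then have "pi * (2 * real (Suc \<nu>)) \<le> pi * real (2 * p + 1)" by (intro mult_left_mono) auto
      then show "x \<le> pi / 2" unfolding x_def by (simp add: field_simps)
    qed (auto simp: x_def)
    have "cos x \<ge> 0" using x by (intro cos_ge_zero) auto
    then have "norm (a \<nu> p) = cos x ^ (2 * m p)"
      using True by (simp add: a_def x_def)
    also have "\<dots> \<le> exp (- x\<^sup>2 / 2) ^ (2 * m p)"
      using x \<open>cos x \<ge> 0\<close> by (intro power_mono cos_le_exp)
    also have "\<dots> = exp (- (real (m p) * x\<^sup>2))"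
      by (simp flip: exp_of_nat_mult)
    also have "real (m p) * x\<^sup>2 = q p * pi\<^sup>2 * (real (Suc \<nu>))\<^sup>2"
      by (simp add: q_def x_def power_divide power_mult_distrib)
    also have "exp (- (q p * pi\<^sup>2 * (real (Suc \<nu>))\<^sup>2)) \<le> exp (- (real (Suc \<nu>) * (\<tau> * pi\<^sup>2 / 2)))"
    proof -
      have "real (Suc \<nu>) * 1 \<le> (real (Suc \<nu>))\<^sup>2"
        unfolding power2_eq_square by (intro mult_left_mono) auto
      then have "(\<tau> / 2 * pi\<^sup>2) * real (Suc \<nu>) \<le> (q p * pi\<^sup>2) * (real (Suc \<nu>))\<^sup>2"
        using that \<tau> by (intro mult_mono) auto
      then show ?thesis by (simp add: mult_ac)
    qed
    also have "\<dots> = exp (- (\<tau> * pi\<^sup>2 / 2)) ^ Suc \<nu>"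
      by (simp only: mult_minus_right flip: exp_of_nat_mult)
    finally show ?thesis .
  qed (simp add: a_def)
  have sum_a: "(\<lambda>p. \<Sum>\<nu>. a \<nu> p) \<longlonglongrightarrow> half_theta t"
    unfolding half_theta_def
  proof (rule conjunct2 [OF conjunct2 [OF tannerys_theorem]])
    show "\<forall>\<^sub>F (\<nu>, p) in at_top \<times>\<^sub>F sequentially. norm (a \<nu> p) \<le> exp (- (\<tau> * pi\<^sup>2 / 2)) ^ Suc \<nu>"
      unfolding eventually_prod_filter using q_bounds bound_a
      by (auto intro!: exI [of _ "\<lambda>_. True"] exI [of _ "\<lambda>p. \<tau> / 2 < q p \<and> q p < 2 * \<tau>"])
    show "summable (\<lambda>\<nu>. exp (- (\<tau> * pi\<^sup>2 / 2)) ^ Suc \<nu>)"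
      using \<tau> by (subst summable_Suc_iff) (auto intro!: summable_geometric)
  qed (use lim_a in auto)

  \<comment> \<open>With K = (k + 1) l, both bounds for the binomial ratio have exponents K^2 / (m +
    s K) with s = -1 or s = 1. Division by l^2 turns these into (k + 1)^2 / (q + s e) with e tending
    to 0, so the two bounds share one limit.\<close>
  have lim_r: "r k \<longlonglongrightarrow> exp (- pi * (real (Suc k))\<^sup>2 * (1 / t))" for k
  proof -
    define e where "e p = real (Suc k) / real (2 * p + 1)" for p
    have e: "e \<longlonglongrightarrow> 0" unfolding e_def by real_asymp
    have "(\<lambda>p. q p - e p) \<longlonglongrightarrow> \<tau> - 0" by (intro tendsto_intros q e)
    moreover have "(0 :: real) < \<tau> - 0" using \<tau> by simp
    ultimately have pos: "\<forall>\<^sub>F p in sequentially. 0 < q p - e p"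
      using order_tendstoD(1) by blast
    have K2: "(real (Suc k * (2 * p + 1)))\<^sup>2 / (real (m p) + s * real (Suc k * (2 * p + 1)))
        = (real (Suc k))\<^sup>2 / (q p + s * e p)" for p s
    proof -
      have l: "real (2 * p + 1) \<noteq> 0" by simp
      have *: "Q * l\<^sup>2 + s * (K * l) = (Q + s * (K / l)) * l\<^sup>2" for Q K l :: real
        by (simp add: power2_eq_square algebra_simps)
      have "real (m p) + s * real (Suc k * (2 * p + 1)) = (q p + s * e p) * (real (2 * p + 1))\<^sup>2"
        unfolding e_def by (subst q_mult, unfold of_nat_mult) (rule *)
      then show ?thesis using l by (simp only: of_nat_mult power_mult_distrib) simp
    qed
    have lim: "(\<lambda>p. exp (- ((real (Suc k))\<^sup>2 / (q p + s * e p)))) \<longlonglongrightarrow> exp (- ((real (Suc k))\<^sup>2 / (\<tau> + s * 0)))" for s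
      using \<tau> by (intro tendsto_intros q e) auto
    have ev: "\<forall>\<^sub>F p in sequentially. Suc k * (2 * p + 1) < m p"
      using pos
    proof eventually_elim
      case (elim p)
      then have "e p * (real (2 * p + 1))\<^sup>2 < q p * (real (2 * p + 1))\<^sup>2"
        by (intro mult_strict_right_mono) auto
      also have "\<dots> = real (m p)" by (simp add: q_mult)
      also have "e p * (real (2 * p + 1))\<^sup>2 = real (Suc k * (2 * p + 1))"
        unfolding e_def power2_eq_square of_nat_mult by simp
      finally show ?case by (simp only: of_nat_less_iff)
    qed
    have "r k \<longlonglongrightarrow> exp (- ((real (Suc k))\<^sup>2 / \<tau>))"
    proof (rule tendsto_sandwich)
      show "\<forall>\<^sub>F p in sequentially. exp (- ((real (Suc k))\<^sup>2 / (q p + (-1) * e p))) \<le> r k p"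
        using ev
      proof eventually_elim
        case (elim p)
        have "real (m p) + - 1 * x = real (m p) - x" for x by simp
        with binomial_ratio_bounds(1) [OF less_imp_le [OF elim] elim] show ?case
          by (simp only: K2 [symmetric] r_def minus_divide_left)
      qed
      show "\<forall>\<^sub>F p in sequentially. r k p \<le> exp (- ((real (Suc k))\<^sup>2 / (q p + 1 * e p)))"
        using ev
      proof eventually_elim
        case (elim p)
        have "real (m p) + 1 * x = real (m p) + x" for x by simp
        with binomial_ratio_bounds(2) [OF less_imp_le [OF elim]] show ?case
          by (simp only: K2 [symmetric] r_def minus_divide_left)
      qed
    qed (use lim [of "-1"] lim [of 1] in simp_all)
    then show ?thesis by (simp add: \<tau>_def mult_ac)
  qed
  \<comment> \<open>For K = (k + 1) l <= m the denominator m + K is at most 2 m, and q < 2 tau then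
    yields the constant 1 / (4 tau). For K > m the ratio is 0.\<close>
  have bound_r: "norm (r k p) \<le> exp (- (1 / (4 * \<tau>))) ^ Suc k" if "0 < q p" "q p < 2 * \<tau>" for k p
  proof (cases "Suc k * (2 * p + 1) \<le> m p")
    case True
    have mp: "real (m p) > 0" using that by (auto simp: q_def zero_less_divide_iff)
    have "norm (r k p) = r k p" by (simp add: r_def)
    also have "r k p \<le> exp (- (real (Suc k * (2 * p + 1)))\<^sup>2 / (real (m p) + real (Suc k * (2 * p + 1))))"
      unfolding r_def by (rule binomial_ratio_bounds(2) [OF True])
    also have "\<dots> \<le> exp (- (real (Suc k) * (1 / (4 * \<tau>))))"
    proof -
      have "real (Suc k) * 1 \<le> (real (Suc k))\<^sup>2"
        unfolding power2_eq_square by (intro mult_left_mono) auto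
      then have "real (Suc k) * (1 / (4 * \<tau>)) \<le> (real (Suc k))\<^sup>2 * (1 / (2 * q p))"
        using that \<tau> by (intro mult_mono) (auto simp: field_simps)
      also have "\<dots> = (real (Suc k * (2 * p + 1)))\<^sup>2 / (2 * real (m p))"
        unfolding q_def of_nat_mult power_mult_distrib by simp
      also have "\<dots> \<le> (real (Suc k * (2 * p + 1)))\<^sup>2 / (real (m p) + real (Suc k * (2 * p + 1)))"
        using True mp by (intro divide_left_mono) (auto simp del: of_nat_mult of_nat_add of_nat_Suc mult_Suc intro!: mult_pos_pos add_pos_nonneg)
      finally show ?thesis by (simp only: exp_le_cancel_iff minus_divide_left [symmetric] neg_le_iff_le)
    qed
    also have "\<dots> = exp (- (1 / (4 * \<tau>))) ^ Suc k"
      by (simp only: mult_minus_right flip: exp_of_nat_mult)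
    finally show ?thesis .
  next
    case False
    then show ?thesis by (simp add: r_def binomial_eq_0 del: mult_Suc)
  qed
  have sum_r: "(\<lambda>p. \<Sum>k. r k p) \<longlonglongrightarrow> half_theta (1 / t)"
    unfolding half_theta_def
  proof (rule conjunct2 [OF conjunct2 [OF tannerys_theorem]])
    have "\<forall>\<^sub>F p in sequentially. 0 < q p \<and> q p < 2 * \<tau>"
      using q_bounds by eventually_elim (use \<tau> in auto)
    then show "\<forall>\<^sub>F (k, p) in at_top \<times>\<^sub>F sequentially. norm (r k p) \<le> exp (- (1 / (4 * \<tau>))) ^ Suc k"
      unfolding eventually_prod_filter using bound_r
      by (auto intro!: exI [of _ "\<lambda>_. True"] exI [of _ "\<lambda>p. 0 < q p \<and> q p < 2 * \<tau>"])
    show "summable (\<lambda>k. exp (- (1 / (4 * \<tau>))) ^ Suc k)"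
      using \<tau> by (subst summable_Suc_iff) (auto intro!: summable_geometric)
  qed (use lim_r in auto)

  \<comment> \<open>The square of this prefactor is 1 / q times the sequence governed by Wallis'
    product, so it tends to (pi / t) (1 / pi) = 1 / t.\<close>
  define c where "c p = real (2 * p + 1) * (real ((2 * m p) choose m p) / 4 ^ m p)" for p
  have c_nonneg: "c p \<ge> 0" for p unfolding c_def by (intro mult_nonneg_nonneg) auto
  have lim_c: "c \<longlonglongrightarrow> 1 / sqrt t"
  proof -
    have "(\<lambda>p. (1 / q p) * (real (m p) * (real ((2 * m p) choose m p) / 4 ^ m p)\<^sup>2)) \<longlonglongrightarrow> (1 / \<tau>) * (1 / pi)"
      using \<tau> by (intro tendsto_intros q filterlim_compose [OF central_binomial_square_tendsto m_top]) auto
    moreover have "\<forall>\<^sub>F p in sequentially. (1 / q p) * (real (m p) * (real ((2 * m p) choose m p) / 4 ^ m p)\<^sup>2) = (c p)\<^sup>2"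
      using q_bounds
    proof eventually_elim
      case (elim p)
      then have "q p > 0" using \<tau> by linarith
      then have "real (m p) \<noteq> 0" by (auto simp: q_def zero_less_divide_iff)
      then show ?case
        unfolding q_def c_def power_mult_distrib by simp
    qed
    ultimately have "(\<lambda>p. (c p)\<^sup>2) \<longlonglongrightarrow> (1 / \<tau>) * (1 / pi)"
      by (rule Lim_transform_eventually)
    then have "(\<lambda>p. sqrt ((c p)\<^sup>2)) \<longlonglongrightarrow> sqrt ((1 / \<tau>) * (1 / pi))"
      by (rule tendsto_real_sqrt)
    then show ?thesis
      using c_nonneg by (simp add: \<tau>_def real_sqrt_divide)
  qed
  have "1 + 2 * (\<Sum>\<nu>. a \<nu> p) = c p * (1 + 2 * (\<Sum>k. r k p))" for p
  proof -
    have "(\<Sum>\<nu>. a \<nu> p) = (\<Sum>\<nu><p. a \<nu> p)"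
      by (intro suminf_finite) (auto simp: a_def)
    also have "\<dots> = (\<Sum>\<nu><p. cos (pi * real (Suc \<nu>) / real (2 * p + 1)) ^ (2 * m p))"
      by (intro sum.cong) (auto simp: a_def)
    finally have 1: "(\<Sum>\<nu>. a \<nu> p) = (\<Sum>\<nu><p. cos (pi * real (Suc \<nu>) / real (2 * p + 1)) ^ (2 * m p))" .
    have 2: "(\<Sum>k. r k p) = (\<Sum>k<m p. r k p)"
    proof (intro suminf_finite)
      fix k assume "k \<notin> {..<m p}"
      then have "m p < Suc k * 1" by simp
      also have "\<dots> \<le> Suc k * (2 * p + 1)" by (intro mult_le_mono2) simp
      finally show "r k p = 0" by (simp add: r_def binomial_eq_0 del: mult_Suc)
    qed simp
    show ?thesis unfolding 1 2 unfolding c_def r_def by (rule sum_cos_power_odd)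
  qed
  moreover have "(\<lambda>p. c p * (1 + 2 * (\<Sum>k. r k p))) \<longlonglongrightarrow> 1 / sqrt t * (1 + 2 * half_theta (1 / t))"
    by (intro tendsto_intros lim_c sum_r)
  moreover have "(\<lambda>p. 1 + 2 * (\<Sum>\<nu>. a \<nu> p)) \<longlonglongrightarrow> 1 + 2 * half_theta t"
    by (intro tendsto_intros sum_a)
  ultimately show ?thesis
    using LIMSEQ_unique by fastforce
qed

theorem theta_functional_equation:
  assumes "t > 0"
  shows "theta (1 / t) = sqrt t * theta t"
  using half_theta_functional_equation [OF assms] assms
  by (simp add: theta_eq_half_theta)

section \<open>Entire functions of two variables\<close>

lemma entire2_const [simp]: "entire2 (\<lambda>_. c)"
  unfolding entire2_def
proof
  fix p :: "complex \<times> complex"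
  have "((\<lambda>_. c) has_derivative (\<lambda>(h, k). 0 * h + 0 * k)) (at p)"
    by (simp add: case_prod_unfold)
  then show "\<exists>a b. ((\<lambda>_. c) has_derivative (\<lambda>(h, k). a * h + b * k)) (at p)" by blast
qed

lemma entire2_linear: "entire2 (\<lambda>(w, s). a * w + b * s)"
  unfolding entire2_def
proof
  fix p :: "complex \<times> complex"
  have "((\<lambda>p. a * fst p + b * snd p) has_derivative (\<lambda>p. a * fst p + b * snd p)) (at p)"
    by (auto intro!: derivative_eq_intros)
  then show "\<exists>c d. ((\<lambda>(w, s). a * w + b * s) has_derivative (\<lambda>(h, k). c * h + d * k)) (at p)"
    unfolding case_prod_unfold by blast
qed

lemma entire2_add:
  assumes "entire2 f" "entire2 g"
  shows "entire2 (\<lambda>p. f p + g p)"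
  unfolding entire2_def
proof
  fix p
  obtain a b c d where "(f has_derivative (\<lambda>(h, k). a * h + b * k)) (at p)"
    "(g has_derivative (\<lambda>(h, k). c * h + d * k)) (at p)"
    using assms unfolding entire2_def by metis
  then have "((\<lambda>p. f p + g p) has_derivative (\<lambda>(h, k). (a + c) * h + (b + d) * k)) (at p)"
    by (auto intro!: derivative_eq_intros simp: case_prod_unfold algebra_simps)
  then show "\<exists>a b. ((\<lambda>p. f p + g p) has_derivative (\<lambda>(h, k). a * h + b * k)) (at p)" by blast
qed

lemma entire2_mult:
  assumes "entire2 f" "entire2 g"
  shows "entire2 (\<lambda>p. f p * g p)"
  unfolding entire2_def
proof
  fix p
  obtain a b c d where "(f has_derivative (\<lambda>(h, k). a * h + b * k)) (at p)"
    "(g has_derivative (\<lambda>(h, k). c * h + d * k)) (at p)"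
    using assms unfolding entire2_def by metis
  then have "((\<lambda>p. f p * g p) has_derivative (\<lambda>(h, k). (f p * c + a * g p) * h + (f p * d + b * g p) * k)) (at p)"
    by (auto intro!: derivative_eq_intros simp: case_prod_unfold algebra_simps)
  then show "\<exists>a b. ((\<lambda>p. f p * g p) has_derivative (\<lambda>(h, k). a * h + b * k)) (at p)" by blast
qed

text \<open>Serves the term J(w, w - s), which comes from the part t > 1 of the defining
  integral.\<close>

lemma entire2_compose_shear:
  assumes "entire2 f"
  shows "entire2 (\<lambda>(w, s). f (w, w - s))"
  unfolding entire2_def
proof
  fix p :: "complex \<times> complex"
  obtain a b where f: "(f has_derivative (\<lambda>(h, k). a * h + b * k)) (at (fst p, fst p - snd p))"
    using assms unfolding entire2_def by metis
  have "((\<lambda>p. (fst p, fst p - snd p)) has_derivative (\<lambda>p. (fst p, fst p - snd p))) (at p)"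
    by (auto intro!: derivative_eq_intros)
  from diff_chain_at [OF this f]
  have "((\<lambda>p. f (fst p, fst p - snd p)) has_derivative (\<lambda>(h, k). (a + b) * h + (- b) * k)) (at p)"
    by (simp add: o_def case_prod_unfold algebra_simps)
  then show "\<exists>a b. ((\<lambda>(w, s). f (w, w - s)) has_derivative (\<lambda>(h, k). a * h + b * k)) (at p)"
    unfolding case_prod_unfold by blast
qed

text \<open>Restriction to complex lines makes the one-variable identity theorem available.\<close>

lemma entire2_holomorphic_on_line:
  assumes "entire2 f"
  shows "(\<lambda>z. f (a + z * b, c + z * d)) holomorphic_on UNIV"
  unfolding holomorphic_on_def
proof
  fix z
  obtain A B where f: "(f has_derivative (\<lambda>(h, k). A * h + B * k)) (at (a + z * b, c + z * d))"
    using assms unfolding entire2_def by metis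
  have "((\<lambda>z. (a + z * b, c + z * d)) has_derivative (\<lambda>h. (h * b, h * d))) (at z)"
    by (auto intro!: derivative_eq_intros)
  from diff_chain_at [OF this f]
  have "((\<lambda>z. f (a + z * b, c + z * d)) has_derivative (\<lambda>h. A * (h * b) + B * (h * d))) (at z)"
    by (simp add: o_def)
  moreover have "(\<lambda>h. A * (h * b) + B * (h * d)) = (*) (A * b + B * d)"
    by (simp add: fun_eq_iff ring_distribs mult_ac)
  ultimately have "((\<lambda>z. f (a + z * b, c + z * d)) has_field_derivative (A * b + B * d)) (at z)"
    by (simp only: has_field_derivative_def)
  then show "(\<lambda>z. f (a + z * b, c + z * d)) field_differentiable at z within UNIV"
    by (auto simp: field_differentiable_def)
qed

text \<open>Join the point (-2, -1) of the region to an arbitrary point by a complex line. The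
  parameters whose points lie in the region form an open set containing 0, so the identity theorem
  carries equality to parameter 1.\<close>

lemma entire2_eqI:
  assumes "entire2 f" "entire2 g"
    and eq: "\<And>w s. Re w < Re s \<Longrightarrow> Re s < 0 \<Longrightarrow> f (w, s) = g (w, s)"
  shows "f = g"
proof
  fix p :: "complex \<times> complex"
  obtain w s where p: "p = (w, s)" by (cases p)
  define U where "U = {z. Re (-2 + z * (w + 2)) < Re (-1 + z * (s + 1)) \<and> Re (-1 + z * (s + 1)) < 0}"
  have "open U"
    unfolding U_def by (intro open_Collect_conj open_Collect_less continuous_intros)
  moreover have "0 \<in> U" by (simp add: U_def)
  then have "U \<noteq> {}" by blast
  ultimately have "(\<lambda>z. f (-2 + z * (w + 2), -1 + z * (s + 1))) 1 = (\<lambda>z. g (-2 + z * (w + 2), -1 + z * (s + 1))) 1"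
    by (intro analytic_continuation_open [of U UNIV "\<lambda>z. f (-2 + z * (w + 2), -1 + z * (s + 1))"
          "\<lambda>z. g (-2 + z * (w + 2), -1 + z * (s + 1))" 1]
          entire2_holomorphic_on_line assms(1,2))
       (auto intro: eq simp del: plus_complex.simps times_complex.simps simp: U_def)
  then show "f p = g p" by (simp add: p)
qed

section \<open>Integrals of exponentials of linear forms\<close>

lemma norm_integral_le:
  fixes f :: "'x \<Rightarrow> 'b::{banach,second_countable_topology}"
  assumes "integrable M f" "integrable M g" "\<And>x. norm (f x) \<le> g x"
  shows "norm (\<integral>x. f x \<partial>M) \<le> (\<integral>x. g x \<partial>M)"
proof -
  have "norm (\<integral>x. f x \<partial>M) \<le> (\<integral>x. norm (f x) \<partial>M)"
    by (rule integral_norm_bound)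
  also have "\<dots> \<le> (\<integral>x. g x \<partial>M)"
    using assms by (intro integral_mono integrable_norm)
  finally show ?thesis .
qed

context
  fixes M :: "'x measure" and c a b :: "'x \<Rightarrow> real"
  assumes measurable [measurable]: "c \<in> borel_measurable M" "a \<in> borel_measurable M" "b \<in> borel_measurable M"
    and c_nonneg: "\<And>x. c x \<ge> 0"
    and integrable_exp_abs: "\<And>K. integrable M (\<lambda>x. c x * exp (K * (\<bar>a x\<bar> + \<bar>b x\<bar>)))"
begin

lemma norm_exp_linear_le:
  fixes w s :: complex
  assumes "norm w \<le> K" "norm s \<le> K"
  shows "norm (of_real (c x) * exp (of_real (a x) * w + of_real (b x) * s))
    \<le> c x * exp (K * (\<bar>a x\<bar> + \<bar>b x\<bar>))"
proof -
  have "Re (of_real (a x) * w + of_real (b x) * s) \<le> \<bar>a x\<bar> * norm w + \<bar>b x\<bar> * norm s"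
    using complex_Re_le_cmod [of "of_real (a x) * w + of_real (b x) * s"]
      norm_triangle_ineq [of "of_real (a x) * w" "of_real (b x) * s"]
    by (simp add: norm_mult)
  also have "\<dots> \<le> \<bar>a x\<bar> * K + \<bar>b x\<bar> * K"
    using assms by (intro add_mono mult_left_mono) auto
  also have "\<dots> = K * (\<bar>a x\<bar> + \<bar>b x\<bar>)" by (simp add: algebra_simps)
  finally show ?thesis
    using c_nonneg by (simp add: norm_mult mult_left_mono)
qed

lemma integrable_exp_linear:
  fixes w s :: complex
  shows "integrable M (\<lambda>x. of_real (c x) * exp (of_real (a x) * w + of_real (b x) * s))"
proof (rule Bochner_Integration.integrable_bound [OF integrable_exp_abs [of "max (norm w) (norm s)"]])
  show "AE x in M. norm (complex_of_real (c x) * exp (of_real (a x) * w + of_real (b x) * s))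
    \<le> norm (c x * exp (max (norm w) (norm s) * (\<bar>a x\<bar> + \<bar>b x\<bar>)))"
    using norm_exp_linear_le [of w "max (norm w) (norm s)" s] c_nonneg by (simp add: abs_mult)
qed simp

lemma norm_integral_exp_linear_le:
  fixes w s :: complex
  assumes "norm w \<le> K" "norm s \<le> K"
  shows "norm (\<integral>x. of_real (c x) * exp (of_real (a x) * w + of_real (b x) * s) \<partial>M)
    \<le> (\<integral>x. c x * exp (K * (\<bar>a x\<bar> + \<bar>b x\<bar>)) \<partial>M)"
  by (intro norm_integral_le integrable_exp_abs integrable_exp_linear norm_exp_linear_le assms)

text \<open>The derivative is built by hand: A and B integrate the formal partial derivatives, and
  the remainder is at most Q |y - p|^2 because |exp z - 1 - z| <= exp |Re z| |z|^2. Polynomial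
  factors in a and b are absorbed by a larger exponential moment.\<close>

lemma entire2_integral_exp_linear:
  "entire2 (\<lambda>(w :: complex, s :: complex). \<integral>x. of_real (c x) * exp (of_real (a x) * w + of_real (b x) * s) \<partial>M)"
  unfolding entire2_def
proof
  fix p :: "complex \<times> complex"
  define E where "E p x = of_real (c x) * exp (of_real (a x) * fst p + of_real (b x) * snd p)"
    for p :: "complex \<times> complex" and x
  define F where "F p = (\<integral>x. E p x \<partial>M)" for p
  define S where "S x = \<bar>a x\<bar> + \<bar>b x\<bar>" for x
  define K where "K = max (norm (fst p)) (norm (snd p))"
  define A where "A = (\<integral>x. of_real (a x) * E p x \<partial>M)"
  define B where "B = (\<integral>x. of_real (b x) * E p x \<partial>M)"
  \<comment> \<open>Of the extra 3 in the exponent, one unit pays for exp |Re z| and two for |z|^2,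
    through S <= exp S.\<close>
  define Q where "Q = (\<integral>x. c x * exp ((K + 3) * S x) \<partial>M)"
  have [measurable]: "E p \<in> borel_measurable M" for p unfolding E_def by simp
  have S_nonneg: "S x \<ge> 0" for x by (simp add: S_def)
  have int_E: "integrable M (E p)" for p
    unfolding E_def by (rule integrable_exp_linear)
  have norm_E: "norm (E p x) \<le> c x * exp (K * S x)" for x
    unfolding E_def S_def by (rule norm_exp_linear_le) (auto simp: K_def)
  have S_le: "S x \<le> exp (S x)" for x
    using exp_ge_add_one_self [of "S x"] by linarith
  have int_S: "integrable M (\<lambda>x. of_real (u x) * E p x)"
    if [measurable]: "u \<in> borel_measurable M" and u: "\<And>x. \<bar>u x\<bar> \<le> S x" for u :: "'x \<Rightarrow> real"
  proof (rule Bochner_Integration.integrable_bound [OF integrable_exp_abs [of "K + 1"]])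
    have "norm (of_real (u x) * E p x) \<le> norm (c x * exp ((K + 1) * S x))" for x
    proof -
      have "norm (of_real (u x) * E p x) \<le> exp (S x) * (c x * exp (K * S x))"
        unfolding norm_mult using u [of x] S_le [of x] by (intro mult_mono norm_E) auto
      also have "\<dots> = c x * exp ((K + 1) * S x)" by (simp add: exp_add algebra_simps)
      also have "\<dots> \<le> norm (c x * exp ((K + 1) * S x))" by simp
      finally show ?thesis .
    qed
    then show "AE x in M. norm (of_real (u x) * E p x) \<le> norm (c x * exp ((K + 1) * (\<bar>a x\<bar> + \<bar>b x\<bar>)))"
      by (simp add: S_def)
  qed simp
  have int_a: "integrable M (\<lambda>x. of_real (a x) * E p x)" and int_b: "integrable M (\<lambda>x. of_real (b x) * E p x)"
    by (auto intro!: int_S simp: S_def)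
  \<comment> \<open>Increments of norm at most 1 keep |z| <= S, so exp |Re z| is bounded by exp
    S.\<close>
  have remainder: "norm (F y - F p - (A * fst (y - p) + B * snd (y - p))) \<le> Q * (norm (y - p))\<^sup>2"
    if y: "norm (y - p) \<le> 1" for y
  proof -
    define h where "h = fst (y - p)"
    define k where "k = snd (y - p)"
    define n where "n = norm (y - p)"
    have hk: "norm h \<le> n" "norm k \<le> n"
      unfolding h_def k_def n_def by (metis norm_fst_le norm_snd_le prod.collapse)+
    have n: "0 \<le> n" "n \<le> 1" using y by (auto simp: n_def)
    have eq: "E y x - E p x - (of_real (a x) * E p x * h + of_real (b x) * E p x * k)
      = E p x * (exp (of_real (a x) * h + of_real (b x) * k) - 1 - (of_real (a x) * h + of_real (b x) * k))" for x
    proof -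
      have "E y x = E p x * exp (of_real (a x) * h + of_real (b x) * k)"
        by (simp add: E_def h_def k_def algebra_simps flip: exp_add)
      then show ?thesis by (simp add: algebra_simps)
    qed
    have bound: "norm (E y x - E p x - (of_real (a x) * E p x * h + of_real (b x) * E p x * k))
        \<le> n\<^sup>2 * (c x * exp ((K + 3) * S x))" for x
    proof -
      define z where "z = of_real (a x) * h + of_real (b x) * k"
      have "norm z \<le> \<bar>a x\<bar> * norm h + \<bar>b x\<bar> * norm k"
        unfolding z_def using norm_triangle_ineq [of "of_real (a x) * h" "of_real (b x) * k"]
        by (simp add: norm_mult)
      also have "\<dots> \<le> \<bar>a x\<bar> * n + \<bar>b x\<bar> * n"
        using hk by (intro add_mono mult_left_mono) auto
      also have "\<dots> = S x * n" by (simp add: S_def algebra_simps)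
      finally have z: "norm z \<le> S x * n" .
      also have "\<dots> \<le> S x * 1" using n S_nonneg by (intro mult_left_mono) auto
      finally have z1: "norm z \<le> S x" by simp
      have "norm (exp z - 1 - z) \<le> exp \<bar>Re z\<bar> * (norm z)\<^sup>2"
        using Taylor_exp [of z 1] by (simp add: diff_diff_eq power2_eq_square)
      also have "\<dots> \<le> exp (S x) * (exp (S x) * n)\<^sup>2"
      proof (intro mult_mono power_mono)
        show "exp \<bar>Re z\<bar> \<le> exp (S x)" using abs_Re_le_cmod [of z] z1 by simp
        have "S x * n \<le> exp (S x) * n" using S_le n by (intro mult_right_mono) auto
        with z show "norm z \<le> exp (S x) * n" by linarith
      qed auto
      also have "\<dots> = n\<^sup>2 * exp (3 * S x)"
      proof -
        have "exp (3 * S x) = exp (S x + S x + S x)" by (rule arg_cong) simp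
        then show ?thesis by (simp only: exp_add power2_eq_square mult_ac)
      qed
      finally have "norm (E p x * (exp z - 1 - z)) \<le> (c x * exp (K * S x)) * (n\<^sup>2 * exp (3 * S x))"
        unfolding norm_mult by (intro mult_mono norm_E) (auto intro!: mult_nonneg_nonneg c_nonneg)
      also have "\<dots> = n\<^sup>2 * (c x * exp ((K + 3) * S x))"
        by (simp add: exp_add algebra_simps)
      finally show ?thesis unfolding eq z_def .
    qed
    have "F y - F p - (A * h + B * k)
        = (\<integral>x. E y x - E p x - (of_real (a x) * E p x * h + of_real (b x) * E p x * k) \<partial>M)"
      unfolding F_def A_def B_def using int_E int_a int_b by simp
    also have "norm \<dots> \<le> (\<integral>x. n\<^sup>2 * (c x * exp ((K + 3) * S x)) \<partial>M)"
      using int_E int_a int_b integrable_exp_abs [of "K + 3"] bound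
      by (intro norm_integral_le) (auto simp: S_def)
    also have "\<dots> = Q * n\<^sup>2" by (simp add: Q_def)
    finally show ?thesis by (simp add: h_def k_def n_def)
  qed
  have "(F has_derivative (\<lambda>q. A * fst q + B * snd q)) (at p)"
  proof (rule has_derivativeI_sandwich [where e = 1 and H = "\<lambda>y. Q * norm (y - p)"])
    show "bounded_linear (\<lambda>q. A * fst q + B * snd q)"
      by (intro bounded_linear_intros)
    show "norm (F y - F p - (A * fst (y - p) + B * snd (y - p))) / norm (y - p) \<le> Q * norm (y - p)"
      if "y \<noteq> p" "dist y p < 1" for y
      using remainder [of y] that by (simp add: dist_norm divide_simps power2_eq_square mult.assoc)
    have "((\<lambda>y. Q * norm (y - p)) \<longlongrightarrow> Q * norm (p - p)) (at p)"
      by (intro tendsto_intros)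
    then show "((\<lambda>y. Q * norm (y - p)) \<longlongrightarrow> 0) (at p)" by simp
  qed simp
  then show "\<exists>A B. ((\<lambda>(w, s). \<integral>x. of_real (c x) * exp (of_real (a x) * w + of_real (b x) * s) \<partial>M)
      has_derivative (\<lambda>(h, k). A * h + B * k)) (at p)"
    unfolding F_def E_def case_prod_unfold by blast
qed

end

section \<open>The entire extension\<close>

lemma half_theta_pos: "t > 0 \<Longrightarrow> half_theta t > 0"
  unfolding half_theta_def using half_theta_sums [of t]
  by (intro suminf_pos) (auto simp: sums_iff)

text \<open>A geometric majorant of ratio q = exp (- pi t) sums to q / (1 - q), and q <= 1/2 for t
  >= 1.\<close>

lemma half_theta_le:
  assumes "t \<ge> 1"
  shows "half_theta t \<le> 2 * exp (- pi * t)"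
proof -
  define q where "q = exp (- pi * t)"
  have "1 * 1 \<le> pi * t" using assms pi_ge_two by (intro mult_mono) auto
  then have "2 \<le> exp (pi * t)" using exp_ge_add_one_self [of "pi * t"] by linarith
  then have q: "0 < q" "q \<le> 1 / 2"
    by (auto simp: q_def exp_minus field_simps)
  have "half_theta t \<le> (\<Sum>n. q ^ Suc n)"
    unfolding half_theta_def
  proof (rule suminf_le)
    show "summable (\<lambda>n. q ^ Suc n)"
      using q by (subst summable_Suc_iff) (auto intro!: summable_geometric)
    show "summable (\<lambda>n. exp (- pi * (real (Suc n))\<^sup>2 * t))"
      using half_theta_sums [of t] assms by (simp add: sums_iff)
    show "exp (- pi * (real (Suc n))\<^sup>2 * t) \<le> q ^ Suc n" for n
      unfolding q_def using assms by (intro half_theta_term_le) auto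
  qed
  also have "\<dots> = q * (1 / (1 - q))"
    using q by (simp add: suminf_mult suminf_geometric summable_geometric)
  also have "\<dots> \<le> q * 2"
    using q by (intro mult_left_mono) (auto simp: field_simps)
  finally show ?thesis by (simp add: q_def)
qed

lemma half_theta_measurable [measurable]: "half_theta \<in> borel_measurable borel"
  unfolding half_theta_def by measurable

text \<open>This is L(t) = ln (theta (t^2)) for t > 0; going through \<open>half_theta\<close> makes
  measurability immediate.\<close>

definition log_theta :: "real \<Rightarrow> real" where
  "log_theta t = ln (1 + 2 * half_theta (t\<^sup>2))"

lemma log_theta_measurable [measurable]: "log_theta \<in> borel_measurable borel"
  unfolding log_theta_def by measurable

lemma log_theta_pos: "t > 0 \<Longrightarrow> log_theta t > 0"
  using half_theta_pos [of "t\<^sup>2"] by (simp add: log_theta_def)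

text \<open>Combine ln (1 + u) <= u with pi t^2 >= t. The rate exp (-t) suffices: half of it will
  absorb powers of t and the other half gives integrability.\<close>

lemma log_theta_le:
  assumes "t \<ge> 1"
  shows "log_theta t \<le> 4 * exp (- t)"
proof -
  have "t\<^sup>2 \<ge> 1" using assms by simp
  have "1 * 1 \<le> pi * t" using assms pi_ge_two by (intro mult_mono) auto
  then have "1 * t \<le> pi * t * t" using assms by (intro mult_right_mono) auto
  have "log_theta t \<le> 2 * half_theta (t\<^sup>2)"
    unfolding log_theta_def using assms half_theta_pos [of "t\<^sup>2"]
    by (intro ln_add_one_self_le_self) auto
  also have "\<dots> \<le> 4 * exp (- pi * t\<^sup>2)"
    using half_theta_le [OF \<open>t\<^sup>2 \<ge> 1\<close>] by simp
  also have "\<dots> \<le> 4 * exp (- t)"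
    using \<open>1 * t \<le> pi * t * t\<close> by (simp add: power2_eq_square mult.assoc)
  finally show ?thesis .
qed

lemma theta_square: "t > 0 \<Longrightarrow> theta (t\<^sup>2) = exp (log_theta t)"
  using half_theta_pos [of "t\<^sup>2"] by (simp add: theta_eq_half_theta log_theta_def exp_ln)

lemma log_theta_inverse:
  assumes "t > 0"
  shows "log_theta (1 / t) = ln t + log_theta t"
proof -
  have "exp (log_theta (1 / t)) = t * exp (log_theta t)"
    using theta_functional_equation [of "t\<^sup>2"] theta_square [of t] theta_square [of "1 / t"] assms
    by (simp add: power_divide)
  also have "\<dots> = exp (ln t + log_theta t)"
    using assms by (simp add: exp_add)
  finally show ?thesis by simp
qed

text \<open>The tangent bound ln u <= u - 1 at u = t / (2 K). In the form t^K <= (2 K)^K exp (t / 2)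
  it replaces the Gamma integral and is the source of the R log R growth.\<close>

lemma powr_le_exp_half:
  fixes K t :: real
  assumes "K \<ge> 1" "t \<ge> 1"
  shows "K * ln t \<le> K * ln (2 * K) + t / 2"
proof -
  have "ln (t / (2 * K)) \<le> t / (2 * K) - 1"
    using assms by (intro ln_le_minus_one) auto
  then have "K * (ln t - ln (2 * K)) \<le> K * (t / (2 * K))"
    using assms by (intro mult_left_mono) (auto simp: ln_div)
  then show ?thesis using assms by (simp add: right_diff_distrib)
qed

section \<open>The kernel of J and its integrable majorant\<close>

text \<open>The pair is (t, y). The variable y in [0, 1] encodes (exp (w L) - 1) / w as the integral
  of L exp (w y L), so that no division by w remains.\<close>

definition weight :: "real \<times> real \<Rightarrow> real" where
  "weight x = indicator {1<..} (fst x) * indicator {0..1} (snd x) * (log_theta (fst x) / fst x)"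

definition kernel_bound :: "real \<times> real \<Rightarrow> real" where
  "kernel_bound x = (indicator {1<..} (fst x) * exp (- fst x / 2)) * indicator {0..1} (snd x)"

lemma weight_measurable [measurable]: "weight \<in> borel_measurable (lborel \<Otimes>\<^sub>M lborel)"
  unfolding weight_def by measurable

lemma weight_nonneg: "weight x \<ge> 0"
  using log_theta_pos [of "fst x"] by (auto simp: weight_def indicator_def)

lemma integrable_exp_half: "integrable lborel (\<lambda>t::real. indicator {1<..} t * exp (- t / 2))"
proof -
  have "(\<integral>\<^sup>+t. ennreal (exp (- t / 2)) * indicator {1..} t \<partial>lborel) = ennreal (0 - (- 2 * exp (- 1 / 2)))"
  proof (rule nn_integral_FTC_atLeast [where F = "\<lambda>t. - 2 * exp (- t / 2)"])
    show "((\<lambda>t::real. - 2 * exp (- t / 2)) \<longlongrightarrow> 0) at_top" by real_asymp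
  qed (auto intro!: derivative_eq_intros)
  then have "(\<integral>\<^sup>+t. ennreal (indicator {1..} t * exp (- t / 2)) \<partial>lborel) < \<infinity>"
    by (simp add: indicator_mult_ennreal mult.commute ennreal_less_top)
  then have "integrable lborel (\<lambda>t::real. indicator {1..} t * exp (- t / 2))"
    by (intro integrableI_nonneg) auto
  then show ?thesis
    by (rule Bochner_Integration.integrable_bound) (auto simp: indicator_def)
qed

lemma integrable_kernel_bound: "integrable (lborel \<Otimes>\<^sub>M lborel) kernel_bound"
proof (rule lborel_pair.Fubini_integrable)
  show "kernel_bound \<in> borel_measurable (lborel \<Otimes>\<^sub>M lborel)"
    unfolding kernel_bound_def by measurable
  have *: "integrable lborel (\<lambda>y::real. indicator {0..1} y :: real)"
    by (intro integrable_real_indicator) auto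
  then show "AE t in lborel. integrable lborel (\<lambda>y. kernel_bound (t, y))"
    by (auto simp: kernel_bound_def)
  show "integrable lborel (\<lambda>t. \<integral>y. norm (kernel_bound (t, y)) \<partial>lborel)"
    using integrable_exp_half * by (simp add: kernel_bound_def abs_mult)
qed

text \<open>For t > 1 and y in [0, 1], y L <= 4 contributes exp (4 K), and t^K costs (2 K)^K exp (t
  / 2). The decay exp (-t) of L pays for the latter and leaves exp (- t / 2).\<close>

lemma weight_exp_le:
  assumes "K \<ge> 1"
  shows "weight x * exp (K * (\<bar>snd x * log_theta (fst x)\<bar> + \<bar>ln (fst x)\<bar>))
    \<le> 4 * exp (4 * K + K * ln (2 * K)) * kernel_bound x"
proof (cases "fst x > 1 \<and> 0 \<le> snd x \<and> snd x \<le> 1")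
  case True
  define t where "t = fst x"
  define y where "y = snd x"
  have t: "t > 1" and y: "0 \<le> y" "y \<le> 1" using True by (auto simp: t_def y_def)
  have L: "0 < log_theta t" "log_theta t \<le> 4 * exp (- t)"
    using log_theta_pos [of t] log_theta_le [of t] t by auto
  have "exp (- t) \<le> 1" using t by simp
  then have L4: "log_theta t \<le> 4" using L by linarith
  have "y * log_theta t \<le> 1 * 4" using y L L4 by (intro mult_mono) auto
  then have "K * (\<bar>y * log_theta t\<bar> + \<bar>ln t\<bar>) \<le> K * (4 + ln t)"
    using assms y L t by (intro mult_left_mono) (auto simp: abs_mult)
  also have "\<dots> \<le> 4 * K + K * ln (2 * K) + t / 2"
    using powr_le_exp_half [OF assms, of t] t by (simp add: algebra_simps)
  finally have e: "exp (K * (\<bar>y * log_theta t\<bar> + \<bar>ln t\<bar>)) \<le> exp (4 * K + K * ln (2 * K) + t / 2)"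
    by simp
  have "log_theta t / t \<le> log_theta t / 1"
    using t L by (intro divide_left_mono) auto
  then have "log_theta t / t \<le> 4 * exp (- t)" using L by simp
  then have "log_theta t / t * exp (K * (\<bar>y * log_theta t\<bar> + \<bar>ln t\<bar>))
      \<le> 4 * exp (- t) * exp (4 * K + K * ln (2 * K) + t / 2)"
    using e t L by (intro mult_mono) auto
  also have "\<dots> = 4 * exp (4 * K + K * ln (2 * K)) * exp (- t / 2)"
  proof -
    have "exp (- t) * exp (t / 2) = exp (- t / 2)" by (simp flip: exp_add)
    then show ?thesis by (simp add: exp_add [of _ "t / 2"])
  qed
  finally show ?thesis
    using t y by (simp add: weight_def kernel_bound_def t_def y_def)
next
  case False
  then show ?thesis by (auto simp: weight_def kernel_bound_def indicator_def)
qed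

lemma integrable_weight_exp:
  "integrable (lborel \<Otimes>\<^sub>M lborel) (\<lambda>x. weight x * exp (K * (\<bar>snd x * log_theta (fst x)\<bar> + \<bar>ln (fst x)\<bar>)))"
proof (rule Bochner_Integration.integrable_bound)
  \<comment> \<open>The majorant is available from 1 on; raising K to \<open>max 1 K\<close> only
    enlarges the integrand.\<close>
  define K' where "K' = max 1 K"
  show "integrable (lborel \<Otimes>\<^sub>M lborel) (\<lambda>x. 4 * exp (4 * K' + K' * ln (2 * K')) * kernel_bound x)"
    by (intro integrable_mult_right integrable_kernel_bound)
  have "norm (weight x * exp (K * (\<bar>snd x * log_theta (fst x)\<bar> + \<bar>ln (fst x)\<bar>)))
      \<le> norm (4 * exp (4 * K' + K' * ln (2 * K')) * kernel_bound x)" for x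
  proof -
    have "norm (weight x * exp (K * (\<bar>snd x * log_theta (fst x)\<bar> + \<bar>ln (fst x)\<bar>)))
      = weight x * exp (K * (\<bar>snd x * log_theta (fst x)\<bar> + \<bar>ln (fst x)\<bar>))"
      using weight_nonneg [of x] by (simp add: abs_mult)
    also have "\<dots> \<le> weight x * exp (K' * (\<bar>snd x * log_theta (fst x)\<bar> + \<bar>ln (fst x)\<bar>))"
      using weight_nonneg [of x] by (intro mult_left_mono) (auto simp: K'_def mult_right_mono)
    also have "\<dots> \<le> 4 * exp (4 * K' + K' * ln (2 * K')) * kernel_bound x"
      by (rule weight_exp_le) (simp add: K'_def)
    also have "\<dots> \<le> norm (4 * exp (4 * K' + K' * ln (2 * K')) * kernel_bound x)" by simp
    finally show ?thesis .
  qed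
  then show "AE x in lborel \<Otimes>\<^sub>M lborel. norm (weight x * exp (K * (\<bar>snd x * log_theta (fst x)\<bar> + \<bar>ln (fst x)\<bar>)))
      \<le> norm (4 * exp (4 * K' + K' * ln (2 * K')) * kernel_bound x)" by simp
qed measurable

text \<open>This is \<open>J(w, \<alpha>)\<close>; the pair \<open>x\<close> is \<open>(t, y)\<close>.\<close>

definition theta_mellin :: "complex \<Rightarrow> complex \<Rightarrow> complex" where
  "theta_mellin w \<alpha> = (\<integral>x. of_real (weight x)
     * exp (of_real (snd x * log_theta (fst x)) * w + of_real (ln (fst x)) * \<alpha>) \<partial>(lborel \<Otimes>\<^sub>M lborel))"

lemma
  shows entire2_theta_mellin: "entire2 (\<lambda>(w, \<alpha>). theta_mellin w \<alpha>)"
    and integrable_theta_mellin: "integrable (lborel \<Otimes>\<^sub>M lborel) (\<lambda>x. of_real (weight x)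
     * exp (of_real (snd x * log_theta (fst x)) * w + of_real (ln (fst x)) * \<alpha>) :: complex)"
  unfolding theta_mellin_def
  by (intro entire2_integral_exp_linear integrable_exp_linear weight_nonneg integrable_weight_exp; measurable)+

lemma norm_theta_mellin_le:
  assumes "K \<ge> 1" "norm w \<le> K" "norm \<alpha> \<le> K"
  shows "norm (theta_mellin w \<alpha>) \<le> 4 * exp (4 * K + K * ln (2 * K)) * (\<integral>x. kernel_bound x \<partial>(lborel \<Otimes>\<^sub>M lborel))"
proof -
  have "norm (theta_mellin w \<alpha>) \<le>
      (\<integral>x. weight x * exp (K * (\<bar>snd x * log_theta (fst x)\<bar> + \<bar>ln (fst x)\<bar>)) \<partial>(lborel \<Otimes>\<^sub>M lborel))"
    unfolding theta_mellin_def
    by (intro norm_integral_exp_linear_le weight_nonneg integrable_weight_exp assms; measurable)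
  also have "\<dots> \<le> (\<integral>x. 4 * exp (4 * K + K * ln (2 * K)) * kernel_bound x \<partial>(lborel \<Otimes>\<^sub>M lborel))"
    by (intro integral_mono integrable_weight_exp integrable_mult_right integrable_kernel_bound weight_exp_le assms)
  finally show ?thesis by simp
qed


section \<open>Evaluating the defining integral in its region of convergence\<close>

text \<open>Fubini with y integrated first: exp (y L w) / w is an antiderivative of L exp (y L w),
  and its increment over [0, 1] recovers exp (w L) - 1 after multiplication by w.\<close>

lemma theta_mellin_fubini:
  assumes "w \<noteq> 0"
  shows "has_bochner_integral lborel
     (\<lambda>t. indicator {1<..} t *\<^sub>R ((exp (of_real (log_theta t) * w) - 1) * exp (of_real (ln t) * \<alpha>) / of_real t))
     (w * theta_mellin w \<alpha>)"
proof -
  define f where "f x = of_real (weight x)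
     * exp (of_real (snd x * log_theta (fst x)) * w + of_real (ln (fst x)) * \<alpha>)" for x :: "real \<times> real"
  have int: "integrable (lborel \<Otimes>\<^sub>M lborel) f"
    unfolding f_def by (rule integrable_theta_mellin)
  have inner: "w * (\<integral>y. f (t, y) \<partial>lborel)
      = indicator {1<..} t *\<^sub>R ((exp (of_real (log_theta t) * w) - 1) * exp (of_real (ln t) * \<alpha>) / of_real t)" for t
  proof (cases "t > 1")
    case True
    define L where "L = log_theta t"
    define e where "e = exp (of_real (ln t) * \<alpha>) / of_real t"
    have "has_bochner_integral lborel
        (\<lambda>y. indicator {0..1} y *\<^sub>R (of_real L * exp (of_real (y * L) * w) * e))
        (exp (of_real (1 * L) * w) / w * e - exp (of_real (0 * L) * w) / w * e)"
    proof (rule has_bochner_integral_FTC_Icc)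
      fix y :: real
      have "((\<lambda>z. exp (z * of_real L * w) / w * e) has_field_derivative of_real L * exp (of_real (y * L) * w) * e) (at (of_real y))"
        using assms by (auto intro!: derivative_eq_intros simp: mult_ac)
      then have "((\<lambda>y. exp (of_real y * of_real L * w) / w * e) has_vector_derivative of_real L * exp (of_real (y * L) * w) * e) (at y within {0..1})"
        by (rule has_vector_derivative_real_field)
      then show "((\<lambda>y. exp (of_real (y * L) * w) / w * e) has_vector_derivative of_real L * exp (of_real (y * L) * w) * e) (at y within {0..1})"
        by simp
    qed (auto intro!: continuous_intros)
    moreover have "f (t, y) = indicator {0..1} y *\<^sub>R (of_real L * exp (of_real (y * L) * w) * e)" for y
      using True by (auto simp: f_def weight_def L_def e_def exp_add indicator_def)
    ultimately have "(\<integral>y. f (t, y) \<partial>lborel) = exp (of_real (1 * L) * w) / w * e - exp (of_real (0 * L) * w) / w * e"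
      by (simp add: has_bochner_integral_integral_eq)
    then show ?thesis
      using True assms by (simp add: L_def e_def field_simps)
  next
    case False
    then show ?thesis by (simp add: f_def weight_def)
  qed
  have "integrable lborel (\<lambda>t. w * (\<integral>y. f (t, y) \<partial>lborel))"
    using lborel_pair.integrable_fst' [OF int] by (rule integrable_mult_right)
  moreover have "(\<integral>t. w * (\<integral>y. f (t, y) \<partial>lborel) \<partial>lborel) = w * theta_mellin w \<alpha>"
    using lborel_pair.integral_fst' [OF int] by (simp only: theta_mellin_def f_def [abs_def] integral_mult_right_zero)
  ultimately show ?thesis
    by (simp only: inner has_bochner_integral_iff)
qed

text \<open>The constant 1 split off from exp (w L) contributes this integral of t^alpha dt/t, the
  source of the polar terms.\<close>

lemma has_bochner_integral_exp_ln:
  fixes \<alpha> :: complex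
  assumes "Re \<alpha> < 0"
  shows "has_bochner_integral lborel (\<lambda>t. indicator {1<..} t *\<^sub>R (exp (of_real (ln t) * \<alpha>) / of_real t)) (- 1 / \<alpha>)"
proof -
  define r where "r = Re \<alpha>"
  have r: "r < 0" using assms by (simp add: r_def)
  have "\<alpha> \<noteq> 0" using assms by auto
  \<comment> \<open>Absolute integrability comes first, from the modulus t^r / t with r = Re alpha;
    the complex fundamental theorem below requires it.\<close>
  have "(\<integral>\<^sup>+t. ennreal (exp (r * ln t) / t) * indicator {1..} t \<partial>lborel) = ennreal (0 - exp (r * ln 1) / r)"
  proof (rule nn_integral_FTC_atLeast [where F = "\<lambda>t. exp (r * ln t) / r"])
    show "((\<lambda>t::real. exp (r * ln t) / r) \<longlongrightarrow> 0) at_top" using r by real_asymp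
    show "((\<lambda>t. exp (r * ln t) / r) has_real_derivative exp (r * ln t) / t) (at t)" if "1 \<le> t" for t
      using that r by (auto intro!: derivative_eq_intros)
  qed auto
  then have "(\<integral>\<^sup>+t. ennreal (indicator {1..} t * (exp (r * ln t) / t)) \<partial>lborel) < \<infinity>"
    by (simp add: indicator_mult_ennreal mult.commute ennreal_less_top)
  then have "integrable lborel (\<lambda>t::real. indicator {1..} t * (exp (r * ln t) / t))"
    by (intro integrableI_nonneg) (auto simp: indicator_def)
  then have int: "set_integrable lborel {1<..} (\<lambda>t. exp (of_real (ln t) * \<alpha>) / of_real t)"
    unfolding set_integrable_def
    by (rule Bochner_Integration.integrable_bound)
       (auto simp: indicator_def norm_divide r_def mult.commute)
  have "(LBINT t=ereal 1..\<infinity>. exp (of_real (ln t) * \<alpha>) / of_real t) = 0 - exp (of_real (ln 1) * \<alpha>) / \<alpha>"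
  proof (rule interval_integral_FTC_integrable [where F = "\<lambda>t. exp (of_real (ln t) * \<alpha>) / \<alpha>"])
    fix t :: real assume "ereal 1 < ereal t"
    then have t: "t > 0" by simp
    have "((\<lambda>t. of_real (ln t) * \<alpha>) has_vector_derivative of_real (1 / t) * \<alpha>) (at t)"
      using t by (auto intro!: derivative_eq_intros simp: has_real_derivative_iff_has_vector_derivative [symmetric])
    from field_vector_diff_chain_at [OF this DERIV_exp]
    have "((\<lambda>t. exp (of_real (ln t) * \<alpha>)) has_vector_derivative of_real (1 / t) * \<alpha> * exp (of_real (ln t) * \<alpha>)) (at t)"
      by (simp add: o_def)
    from has_vector_derivative_divide [OF this, of \<alpha>]
    show "((\<lambda>t. exp (of_real (ln t) * \<alpha>) / \<alpha>) has_vector_derivative exp (of_real (ln t) * \<alpha>) / of_real t) (at t)"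
      using \<open>\<alpha> \<noteq> 0\<close> by simp
    show "isCont (\<lambda>t. exp (of_real (ln t) * \<alpha>) / of_real t) t"
      using t by (intro continuous_intros) auto
  next
    show "(((\<lambda>t. exp (of_real (ln t) * \<alpha>) / \<alpha>) \<circ> real_of_ereal) \<longlongrightarrow> exp (of_real (ln 1) * \<alpha>) / \<alpha>) (at_right (ereal 1))"
      unfolding ereal_tendsto_simps using \<open>\<alpha> \<noteq> 0\<close> by (intro tendsto_intros) auto
    have "((\<lambda>t. exp (r * ln t)) \<longlongrightarrow> 0) at_top" using r by real_asymp
    then have "((\<lambda>t. exp (of_real (ln t) * \<alpha>)) \<longlongrightarrow> 0) at_top"
      by (subst tendsto_norm_zero_iff [symmetric]) (simp add: r_def mult.commute)
    from tendsto_divide [OF this tendsto_const [of \<alpha>]]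
    show "(((\<lambda>t. exp (of_real (ln t) * \<alpha>) / \<alpha>) \<circ> real_of_ereal) \<longlongrightarrow> 0) (at_left \<infinity>)"
      unfolding ereal_tendsto_simps using \<open>\<alpha> \<noteq> 0\<close> by simp
  qed (use int in auto)
  then show ?thesis
    using int by (simp add: has_bochner_integral_iff set_integrable_def interval_lebesgue_integral_def set_lebesgue_integral_def)
qed

lemma theta_powr_mellin:
  assumes "w \<noteq> 0" "Re \<alpha> < 0"
  shows "has_bochner_integral lborel
     (\<lambda>t. indicator {1<..} t *\<^sub>R (exp (of_real (log_theta t) * w + of_real (ln t) * \<alpha>) / of_real t))
     (w * theta_mellin w \<alpha> - 1 / \<alpha>)"
proof -
  have "w * theta_mellin w \<alpha> - 1 / \<alpha> = w * theta_mellin w \<alpha> + (- 1 / \<alpha>)" by simp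
  moreover have "indicator {1<..} t *\<^sub>R (exp (of_real (log_theta t) * w + of_real (ln t) * \<alpha>) / of_real t)
    = indicator {1<..} t *\<^sub>R ((exp (of_real (log_theta t) * w) - 1) * exp (of_real (ln t) * \<alpha>) / of_real t)
      + indicator {1<..} t *\<^sub>R (exp (of_real (ln t) * \<alpha>) / of_real t)" for t
    by (simp add: exp_add diff_divide_distrib algebra_simps)
  ultimately show ?thesis
    using has_bochner_integral_add [OF theta_mellin_fubini [OF assms(1)] has_bochner_integral_exp_ln [OF assms(2)]]
    by (simp only:)
qed

text \<open>The substitution t = 1 / u, with Jacobian 1 / u^2, carries the part of the integral
  below 1 to the half-line above 1.\<close>

lemma has_bochner_integral_inverse:
  fixes f :: "real \<Rightarrow> complex"
  assumes [measurable]: "f \<in> borel_measurable borel"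
    and "has_bochner_integral lborel (\<lambda>u. indicator {1<..} u *\<^sub>R (f (1 / u) / of_real (u\<^sup>2))) I"
  shows "has_bochner_integral lborel (\<lambda>t. indicator {0<..<1} t *\<^sub>R f t) I"
proof -
  have int: "set_integrable lborel {1<..} (\<lambda>u. f (1 / u) / of_real (u\<^sup>2))"
    and eq: "(LINT u:{1<..}|lborel. f (1 / u) / of_real (u\<^sup>2)) = I"
    using assms(2) by (simp_all add: has_bochner_integral_iff set_integrable_def set_lebesgue_integral_def)
  have scale: "\<bar>- (1 / u\<^sup>2)\<bar> *\<^sub>R f (1 / u) = f (1 / u) / of_real (u\<^sup>2)" for u :: real
    by (simp add: scaleR_conv_of_real field_simps)
  \<comment> \<open>The change of variables theorem speaks of Lebesgue measure, the completion of
    \<open>lborel\<close>; Borel measurability of f allows passing back and forth.\<close>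
  have "(\<lambda>u. f (1 / u) / of_real (u\<^sup>2)) absolutely_integrable_on {1<..}"
    using int unfolding set_integrable_def by (subst integrable_completion) auto
  moreover have "integral {1<..} (\<lambda>u. f (1 / u) / of_real (u\<^sup>2)) = I"
    using set_borel_integral_eq_integral(2) [OF int] eq by simp
  moreover have "(\<lambda>u::real. 1 / u) ` {1<..} = {0<..<1}"
  proof safe
    fix t :: real assume "t \<in> {0<..<1}"
    then have "t = 1 / (1 / t)" "1 / t \<in> {1<..}" by (auto simp: field_simps)
    then show "t \<in> (\<lambda>u. 1 / u) ` {1<..}" by blast
  qed (auto simp: field_simps)
  moreover have der: "((\<lambda>u. 1 / u) has_real_derivative - (1 / u\<^sup>2)) (at u within {1<..})" if "u \<in> {1<..}" for u
    using that by (auto intro!: derivative_eq_intros simp: power2_eq_square)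
  moreover have inj: "inj_on (\<lambda>u::real. 1 / u) {1<..}" by (auto simp: inj_on_def)
  moreover have "{1::real<..} \<in> sets lebesgue" by simp
  note has_absolute_integral_change_of_variables_real [OF this der inj, of f I, unfolded scale]
  ultimately have "f absolutely_integrable_on {0<..<1} \<and> integral {0<..<1} f = I"
    by (simp only:) simp
  moreover from this have "set_integrable lborel {0<..<1} f"
    unfolding set_integrable_def by (subst (asm) integrable_completion) auto
  ultimately show ?thesis
    using set_borel_integral_eq_integral(2) [of "{0<..<1}" f]
    by (simp add: has_bochner_integral_iff set_integrable_def set_lebesgue_integral_def)
qed

text \<open>Split at t = 1 and invert the lower part. Since L(1/t) = ln t + L(t), the exponent L(t)
  s + L(1/t) (w - s) becomes L(t) w + (w - s) ln t above 1, and L(u) w + s ln u below 1 with u =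
  1/t.\<close>

lemma Z_Q_eq:
  assumes "Re w < Re s" "Re s < 0"
  shows "Z_Q w s = w * (theta_mellin w s + theta_mellin w (w - s)) - 1 / s - 1 / (w - s)"
proof -
  have "w \<noteq> 0" "Re (w - s) < 0" using assms by auto
  define f where "f t = exp (of_real (log_theta t) * s + of_real (log_theta (1 / t)) * (w - s)) / of_real t" for t
  have f_meas [measurable]: "f \<in> borel_measurable borel"
    unfolding f_def by measurable
  have "f t = exp (of_real (log_theta t) * w + of_real (ln t) * (w - s)) / of_real t" if "t > 1" for t
    using that by (simp add: f_def log_theta_inverse algebra_simps)
  then have "indicator {1<..} t *\<^sub>R f t
      = indicator {1<..} t *\<^sub>R (exp (of_real (log_theta t) * w + of_real (ln t) * (w - s)) / of_real t)" for t
    by (cases "t > 1") simp_all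
  then have upper: "has_bochner_integral lborel (\<lambda>t. indicator {1<..} t *\<^sub>R f t) (w * theta_mellin w (w - s) - 1 / (w - s))"
    using theta_powr_mellin [OF \<open>w \<noteq> 0\<close> \<open>Re (w - s) < 0\<close>] by (simp only:)
  have lower: "has_bochner_integral lborel (\<lambda>t. indicator {0<..<1} t *\<^sub>R f t) (w * theta_mellin w s - 1 / s)"
  proof (rule has_bochner_integral_inverse [OF f_meas])
    have "f (1 / u) / of_real (u\<^sup>2) = exp (of_real (log_theta u) * w + of_real (ln u) * s) / of_real u" if "u > 1" for u
      using that by (simp add: f_def log_theta_inverse power2_eq_square algebra_simps)
    then have "indicator {1<..} u *\<^sub>R (f (1 / u) / of_real (u\<^sup>2))
        = indicator {1<..} u *\<^sub>R (exp (of_real (log_theta u) * w + of_real (ln u) * s) / of_real u)" for u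
      by (cases "u > 1") simp_all
    then show "has_bochner_integral lborel (\<lambda>u. indicator {1<..} u *\<^sub>R (f (1 / u) / of_real (u\<^sup>2))) (w * theta_mellin w s - 1 / s)"
      using theta_powr_mellin [OF \<open>w \<noteq> 0\<close> assms(2)] by (simp only:)
  qed
  have integrand: "complex_of_real (theta (t\<^sup>2)) powr s * complex_of_real (theta (1 / t\<^sup>2)) powr (w - s) / complex_of_real t = f t"
    if "t > 0" for t
  proof -
    have powr: "complex_of_real (exp x) powr z = exp (of_real x * z)" for x z
      by (simp add: powr_def Ln_of_real mult.commute flip: exp_of_real)
    have "theta (1 / t\<^sup>2) = exp (log_theta (1 / t))"
      using theta_square [of "1 / t"] that by (simp add: power_divide)
    then show ?thesis
      using that by (simp only: theta_square powr f_def exp_add)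
  qed
  have "Z_Q w s = (LINT t|lborel. indicator {0<..} t *\<^sub>R f t)"
    unfolding Z_Q_def set_lebesgue_integral_def
  proof (intro Bochner_Integration.integral_cong refl)
    fix t :: real
    show "indicator {0<..} t *\<^sub>R (complex_of_real (theta (t\<^sup>2)) powr s * complex_of_real (theta (1 / t\<^sup>2)) powr (w - s) / complex_of_real t)
        = indicator {0<..} t *\<^sub>R f t"
      by (cases "t > 0") (simp_all only: integrand indicator_simps greaterThan_iff scaleR_zero_left not_False_eq_True)
  qed
  also have "\<dots> = (LINT t|lborel. indicator {0<..<1} t *\<^sub>R f t + indicator {1<..} t *\<^sub>R f t)"
  proof (rule integral_cong_AE)
    \<comment> \<open>The two open pieces miss only the null set {1}.\<close>
    show "AE t in lborel. indicator {0<..} t *\<^sub>R f t = indicator {0<..<1} t *\<^sub>R f t + indicator {1<..} t *\<^sub>R f t"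
      using AE_lborel_singleton [of "1 :: real"] by eventually_elim (auto simp: indicator_def)
  qed measurable
  also have "\<dots> = (w * theta_mellin w s - 1 / s) + (w * theta_mellin w (w - s) - 1 / (w - s))"
    using has_bochner_integral_add [OF lower upper] by (rule has_bochner_integral_integral_eq)
  finally show ?thesis by (simp add: algebra_simps)
qed

section \<open>The entire extension in closed form and its growth\<close>

text \<open>The polar terms add up to w / (s (s - w)), which the prefactor s (s - w) / (2 w) turns
  into 1/2. The resulting entire function witnesses existence for the definite description, and
  \<open>entire2_eqI\<close> gives uniqueness.\<close>

lemma xi_Q_eq:
  "xi_Q = (\<lambda>(w, s). 1 / 2 + s * (s - w) / 2 * (theta_mellin w s + theta_mellin w (w - s)))"
proof -
  define F where "F = (\<lambda>(w, s). 1 / 2 + s * (s - w) / 2 * (theta_mellin w s + theta_mellin w (w - s)))"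
  \<comment> \<open>The function is spelled out so that each piece matches a closure lemma; the
    linear forms are s / 2 and s - w.\<close>
  have "entire2 (\<lambda>p. 1 / 2 + (\<lambda>(w, s). 0 * w + 1 / 2 * s) p * (\<lambda>(w, s). - 1 * w + 1 * s) p
      * ((\<lambda>(w, s). theta_mellin w s) p + (\<lambda>(w, s). (\<lambda>(w, s). theta_mellin w s) (w, w - s)) p))"
    by (intro entire2_add entire2_mult entire2_const entire2_linear entire2_theta_mellin entire2_compose_shear)
  moreover have "F = (\<lambda>p. 1 / 2 + (\<lambda>(w, s). 0 * w + 1 / 2 * s) p * (\<lambda>(w, s). - 1 * w + 1 * s) p
      * ((\<lambda>(w, s). theta_mellin w s) p + (\<lambda>(w, s). (\<lambda>(w, s). theta_mellin w s) (w, w - s)) p))"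
    by (auto simp: F_def fun_eq_iff)
  ultimately have "entire2 F" by (simp only:)
  moreover have "F (w, s) = s * (s - w) / (2 * w) * Z_Q w s" if "Re w < Re s" "Re s < 0" for w s
  proof -
    have ne: "w \<noteq> 0" "s \<noteq> 0" "s - w \<noteq> 0" "w - s \<noteq> 0" using that by auto
    define T where "T = theta_mellin w s + theta_mellin w (w - s)"
    have "1 / s + 1 / (w - s) = - (w / (s * (s - w)))"
      using ne by (simp add: divide_simps) (simp add: algebra_simps)
    then have "Z_Q w s = w * T + w / (s * (s - w))"
      using Z_Q_eq [OF that] by (simp add: T_def algebra_simps)
    moreover have "F (w, s) = 1 / 2 + s * (s - w) / 2 * T" by (simp add: F_def T_def)
    moreover have "s * d / (2 * w) * (w * T + w / (s * d)) = 1 / 2 + s * d / 2 * T" if "d \<noteq> 0" for d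
      using that ne by (simp add: field_simps)
    ultimately show ?thesis
      using ne by (simp only:) simp
  qed
  ultimately have "xi_Q = F"
    unfolding xi_Q_def by (intro the_equality) (auto intro: entire2_eqI)
  then show ?thesis by (simp add: F_def)
qed

theorem theorem4p1:
  "\<exists>C::real. C > 0 \<and> (\<forall>w s :: complex.
     let R = norm w + norm s + 1 in norm (xi_Q (w, s)) \<le> exp (C * R * ln R))"
proof -
  define B where "B = (\<integral>x. kernel_bound x \<partial>(lborel \<Otimes>\<^sub>M lborel))"
  define A where "A = 4 * B * exp 5"
  have "B \<ge> 0"
    unfolding B_def by (intro Bochner_Integration.integral_nonneg) (auto simp: kernel_bound_def)
  then have A: "A \<ge> 0" by (simp add: A_def)
  have bound: "norm (xi_Q (w, s)) \<le> exp ((7 + A) * R * ln R)" if R: "R = norm w + norm s + 1" for w s R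
  proof -
    define x where "x = R * ln R"
    have R1: "R \<ge> 1" using R by simp
    \<comment> \<open>This yields R - 1 <= R ln R, which lets both R - 1 and |s| |s - w| be measured
      by x alone.\<close>
    have "ln (1 / R) \<le> 1 / R - 1" using R1 by (intro ln_le_minus_one) auto
    then have "R * (1 - 1 / R) \<le> R * ln R" using R1 by (intro mult_left_mono) (auto simp: ln_div)
    then have x: "R - 1 \<le> x" using R1 by (simp add: x_def right_diff_distrib)
    then have x0: "x \<ge> 0" using R1 by linarith
    have norms: "norm w \<le> R" "norm s \<le> R" "norm (w - s) \<le> R" "norm s \<le> R - 1" "norm (s - w) \<le> R - 1"
      using norm_triangle_ineq4 [of w s] norm_triangle_ineq4 [of s w] R by auto
    have "ln 2 \<le> (1 :: real)" using ln_2_less_1 by simp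
    then have "ln (2 * R) \<le> 1 + ln R" using R1 by (simp add: ln_mult)
    then have "R * ln (2 * R) \<le> R * (1 + ln R)" using R1 by (intro mult_left_mono) auto
    \<comment> \<open>The left side is at most 5 R + x, and R <= 1 + x.\<close>
    then have "4 * R + R * ln (2 * R) \<le> 5 + 6 * x" using x by (simp add: x_def algebra_simps)
    then have E: "exp (4 * R + R * ln (2 * R)) \<le> exp 5 * exp (6 * x)" by (simp flip: exp_add)
    have J: "norm (theta_mellin w \<alpha>) \<le> A * exp (6 * x)" if "norm \<alpha> \<le> R" for \<alpha>
    proof -
      have "norm (theta_mellin w \<alpha>) \<le> 4 * exp (4 * R + R * ln (2 * R)) * B"
        unfolding B_def by (rule norm_theta_mellin_le [OF R1 norms(1) that])
      also have "\<dots> \<le> 4 * (exp 5 * exp (6 * x)) * B"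
        using E \<open>B \<ge> 0\<close> by (intro mult_right_mono mult_left_mono) auto
      finally show ?thesis by (simp add: A_def mult_ac)
    qed
    have "norm (theta_mellin w s + theta_mellin w (w - s)) \<le> 2 * (A * exp (6 * x))"
      using norm_triangle_ineq [of "theta_mellin w s" "theta_mellin w (w - s)"] J [OF norms(2)] J [OF norms(3)]
      by linarith
    then have "norm s * norm (s - w) / 2 * norm (theta_mellin w s + theta_mellin w (w - s)) \<le> x * x / 2 * (2 * (A * exp (6 * x)))"
      using norms x x0 by (intro mult_mono divide_right_mono) auto
    also have "\<dots> = A * x * (x * exp (6 * x))" by simp
    \<comment> \<open>Only one of the two factors x is absorbed into the exponential. The other
      stays with A, so that the term vanishes at R = 1 and 1 + A x <= exp (A x) applies; this gives
      the constant 7 + A.\<close>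
    also have "\<dots> \<le> A * x * (exp x * exp (6 * x))"
    proof -
      have "x \<le> exp x" using exp_ge_add_one_self [of x] by linarith
      then show ?thesis using A x0 by (intro mult_left_mono mult_right_mono) auto
    qed
    also have "exp x * exp (6 * x) = exp (7 * x)" by (simp flip: exp_add)
    finally have "norm s * norm (s - w) / 2 * norm (theta_mellin w s + theta_mellin w (w - s)) \<le> A * x * exp (7 * x)" .
    moreover have "norm (xi_Q (w, s)) \<le> 1 / 2 + norm s * norm (s - w) / 2 * norm (theta_mellin w s + theta_mellin w (w - s))"
      using norm_triangle_ineq [of "1 / 2" "s * (s - w) / 2 * (theta_mellin w s + theta_mellin w (w - s))"]
      by (simp add: xi_Q_eq norm_mult norm_divide)
    ultimately have "norm (xi_Q (w, s)) \<le> 1 + A * x * exp (7 * x)" by linarith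
    also have "\<dots> \<le> exp (7 * x) * (1 + A * x)"
      using x0 by (simp add: algebra_simps)
    also have "\<dots> \<le> exp (7 * x) * exp (A * x)"
      by (intro mult_left_mono exp_ge_add_one_self) auto
    also have "\<dots> = exp ((7 + A) * R * ln R)"
      by (simp add: x_def algebra_simps flip: exp_add)
    finally show ?thesis .
  qed
  show ?thesis
    using A bound by (intro exI [of _ "7 + A"]) (auto simp: Let_def)
qed

end
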